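(* Let $d\geq 3$ be fixed and let $\alpha>\frac{1}{2(d-1)}$ be fixed. If $G$ is an $(n,d,\lambda)$-graph satisfying $\lambda\leq 2\sqrt{d-1}+\frac{1}{40}$, $\rho(G,39+2(d-1))\leq 1$, and $t(G)=O\big(n^{\frac{2d-3}{2(d-1)}}\big)$, and $\widehat{G}$ is the random graph obtained from $G$ by deleting every vertex independently with probability $p=n^{-\alpha}$, then w.h.p. all small connected components of $\widehat{G}$ are isolated vertices.
   Context: Graphs are finite and simple. For a $d$-regular graph $G$ on $n$ vertices let $d=\lambda_0\ge\lambda_1\ge\dots\ge\lambda_{n-1}$ be the eigenvalues of its adjacency matrix, and $\lambda(G)=\max\{|\lambda_1|,|\lambda_{n-1}|\}$. An $(n,d,\lambda)$-graph is a $d$-regular graph $G$ on $n$ vertices with $\lambda(G)=\lambda$. For a graph $G=(V,E)$ and a positive number $M$, $\rho(G,M)=\max\left\{\frac{e(U)}{|U|}: \emptyset\neq U\subseteq V,\ |U|\le M\right\}$, where $e(U)$ is the number of edges of $G$ with both endpoints in $U$. $t(G)$ is the number of triangles in $G$. Deletion process: each vertex of $G$ is deleted independently with probability $n^{-\alpha}$; $\widehat{G}$ is the subgraph of $G$ induced by the non-deleted vertices. Order the vertex sets of the connected components of $\widehat{G}$ as $\widehat{V}_1,\dots,\widehat{V}_s$ in descending order of cardinality; the small connected components are $\widehat{V}_2,\dots,\widehat{V}_s$ (all components except the largest one). Asymptotics are as $n\to\infty$: the statement is about every family $\{G_n\}$ of graphs ($G_n$ on $n$ vertices) satisfying the hypotheses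 with $\alpha,d$ fixed (and a fixed implied constant in the $O(\cdot)$), and an event holds w.h.p. if its probability tends to $1$ as $n\to\infty$. *)

theory Defs
  imports
    "Graph_Theory.Pair_Digraph"
    "Graph_Theory.Digraph_Component"
    "Jordan_Normal_Form.Char_Poly"
    "HOL-Probability.Product_PMF"
    "HOL-Library.Landau_Symbols"
begin

text \<open>
  A finite simple graph is a \<^term>\<open>pair_graph\<close>: a finite, loop-free, symmetric relation on a
  finite vertex set, an edge \<open>{u, v}\<close> being the pair of arcs \<open>(u, v)\<close>, \<open>(v, u)\<close>.
\<close>

definition regular_graph :: "'a pair_pre_digraph \<Rightarrow> nat \<Rightarrow> bool" where
  "regular_graph G d \<longleftrightarrow> pair_graph G \<and> (\<forall>v\<in>pverts G. out_degree G v = d)"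

text \<open>
  The linear order on the vertex type only serves to number the rows and columns; the spectrum
  does not depend on the numbering.
\<close>

definition adjacency_matrix :: "'a::linorder pair_pre_digraph \<Rightarrow> real mat" where
  "adjacency_matrix G =
     (let vs = sorted_list_of_set (pverts G)
      in Matrix.mat (length vs) (length vs) (\<lambda>(i, j). if (vs ! i, vs ! j) \<in> parcs G then 1 else 0))"

text \<open>
  The eigenvalues \<open>\<lambda>\<^sub>0 \<ge> \<dots> \<ge> \<lambda>\<^bsub>n-1\<^esub>\<close>, listed with multiplicity. A real symmetric matrix has
  \<open>n\<close> real eigenvalues, so that the real roots of the characteristic polynomial are all of them.
\<close>

definition eigenvalue_list :: "'a::linorder pair_pre_digraph \<Rightarrow> real list" where
  "eigenvalue_list G = rev (sorted_list_of_multiset (proots (char_poly (adjacency_matrix G))))"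

definition second_eigenvalue :: "'a::linorder pair_pre_digraph \<Rightarrow> real" where
  "second_eigenvalue G =
     max \<bar>eigenvalue_list G ! 1\<bar> \<bar>eigenvalue_list G ! (card (pverts G) - 1)\<bar>"

definition ndlambda_graph :: "'a::linorder pair_pre_digraph \<Rightarrow> nat \<Rightarrow> nat \<Rightarrow> real \<Rightarrow> bool" where
  "ndlambda_graph G n d lam \<longleftrightarrow>
     regular_graph G d \<and> card (pverts G) = n \<and> second_eigenvalue G = lam"

definition edges_within :: "'a pair_pre_digraph \<Rightarrow> 'a set \<Rightarrow> 'a set set" where
  "edges_within G U = {{u, v} | u v. (u, v) \<in> parcs G \<and> u \<in> U \<and> v \<in> U}"

definition max_density :: "'a pair_pre_digraph \<Rightarrow> real \<Rightarrow> real" where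
  "max_density G M =
     Max {real (card (edges_within G U)) / real (card U) | U.
            U \<noteq> {} \<and> U \<subseteq> pverts G \<and> real (card U) \<le> M}"

definition num_triangles :: "'a pair_pre_digraph \<Rightarrow> nat" where
  "num_triangles G =
     card {T. T \<subseteq> pverts G \<and> card T = 3 \<and> (\<forall>u\<in>T. \<forall>v\<in>T. u \<noteq> v \<longrightarrow> (u, v) \<in> parcs G)}"

text \<open>In the product space below, the value \<^term>\<open>True\<close> at \<open>v\<close> means that \<open>v\<close> is deleted.\<close>

definition deletion_pmf :: "'a pair_pre_digraph \<Rightarrow> real \<Rightarrow> ('a, 'a \<times> 'a) pre_digraph pmf" where
  "deletion_pmf G p =
     map_pmf (\<lambda>del. with_proj G \<restriction> {v \<in> pverts G. \<not> del v})
       (Pi_pmf (pverts G) False (\<lambda>_. bernoulli_pmf p))"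

text \<open>
  Since all graphs here are symmetric, the strongly connected components are the connected
  components. The small components are all but the first one in an ordering by descending
  cardinality. The choice among several largest components is irrelevant below, and we quantify
  over all such orderings.
\<close>

definition component_ordering :: "('a, 'b) pre_digraph \<Rightarrow> 'a set list \<Rightarrow> bool" where
  "component_ordering H Vs \<longleftrightarrow>
     distinct Vs \<and> set Vs = pre_digraph.sccs_verts H \<and> sorted_wrt (\<lambda>A B. card A \<ge> card B) Vs"

definition isolated_vertex :: "('a, 'b) pre_digraph \<Rightarrow> 'a \<Rightarrow> bool" where
  "isolated_vertex H v \<longleftrightarrow> v \<in> verts H \<and> (\<forall>u. (u, v) \<notin> arcs_ends H \<and> (v, u) \<notin> arcs_ends H)"

definition small_components_isolated :: "('a, 'b) pre_digraph \<Rightarrow> bool" where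
  "small_components_isolated H \<longleftrightarrow>
     (\<forall>Vs. component_ordering H Vs \<longrightarrow>
        (\<forall>C\<in>set (tl Vs). \<exists>v. isolated_vertex H v \<and> C = {v}))"

end

theory Submission
  imports Defs "Jordan_Normal_Form.Schur_Decomposition"
begin

text \<open>
  Write \<open>p = n powr - \<alpha>\<close> and let \<open>N(U)\<close> be the set of vertices outside \<open>U\<close> that have a neighbour
  in \<open>U\<close>. If the conclusion fails, then some connected set \<open>U\<close> of \<open>G\<close> with \<open>2 \<le> |U| \<le> n/2\<close> is cut
  off: all of \<open>N(U)\<close> is deleted, an event of probability \<open>p ^ |N(U)|\<close>. The theorem is a union bound
  over these sets, and it needs many boundary vertices for few sets. Since \<open>n * p ^ (2d - 2)\<close> tends
  to 0 exactly because \<open>\<alpha> > 1 / (2 (d - 1))\<close>, the aim is \<open>|N(U)| \<ge> 2d - 2\<close> with a gain that is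
  linear in \<open>|U|\<close> for larger sets.

  \<^item> For \<open>2 \<le> |U| \<le> 39\<close> the bound comes from sparsity (\<open>small_set_expansion\<close>): \<open>d |U| - e(U)\<close> edges
    meet \<open>U\<close>, and all of them lie inside \<open>U \<union> N(U)\<close>, which spans at most \<open>|U| + |N(U)|\<close> edges unless
    it is so large that nothing is left to prove. The only exceptions are edges and triangles that
    lie in a triangle, where \<open>|N(U)| \<ge> 2d - 3\<close>. There are \<open>O(t(G))\<close> of them, and
    \<open>t(G) * p ^ (2d - 3)\<close> tends to 0 by the hypothesis on \<open>t(G)\<close>.

  \<^item> For \<open>40 \<le> |U| \<le> n/2\<close> the bound comes from the spectral gap (\<open>large_set_expansion\<close>). Tanner's
    inequality gives \<open>|U| + |N(U)| \<ge> (d\<^sup>2/\<lambda>\<^sup>2 - o(1)) |U|\<close> for sets of size \<open>o(n)\<close>. The bound on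
    \<open>\<lambda>\<close> makes \<open>d\<^sup>2/\<lambda>\<^sup>2\<close> exceed \<open>1 + (d - 1)/20\<close>, and \<open>40 (d - 1)/20 = 2 (d - 1)\<close>: this is where
    the sizes 39 and 40 meet.

  \<^item> There are at most \<open>n * d ^ (2(k - 1))\<close> connected sets of size \<open>k\<close> (\<open>card_connected_sets_le\<close>), and
    the exponential factor is absorbed by the linear gain in \<open>|N(U)|\<close>, as \<open>p\<close> tends to 0.

  The spectral input is that \<open>|A x| \<le> \<lambda> |x|\<close> for every \<open>x\<close> orthogonal to the constant vector, with
  \<open>\<lambda>\<close> defined through the roots of the characteristic polynomial. It is obtained by the trace method
  (\<open>second_eigenvalue_operator_bound\<close>), which avoids orthonormal eigenbases and any discussion of
  the multiplicity of the eigenvalue \<open>d\<close>.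
\<close>

unbundle no vec_syntax


section \<open>Traces of powers and eigenvalues of real symmetric matrices\<close>

definition mat_trace :: "'a::comm_ring_1 mat \<Rightarrow> 'a" where
  "mat_trace M = (\<Sum>i<dim_row M. M $$ (i, i))"

lemma mat_trace_mult_commute:
  assumes "A \<in> carrier_mat n n" "B \<in> carrier_mat n n"
  shows "mat_trace (A * B) = mat_trace (B * A)"
proof -
  have entry: "(X * Y) $$ (i, i) = (\<Sum>j<n. X $$ (i, j) * Y $$ (j, i))"
    if "X \<in> carrier_mat n n" "Y \<in> carrier_mat n n" "i < n" for X Y :: "'a mat" and i
    using that by (auto simp: scalar_prod_def lessThan_atLeast0)
  have "mat_trace (A * B) = (\<Sum>i<n. \<Sum>j<n. A $$ (i, j) * B $$ (j, i))"
    using assms unfolding mat_trace_def by (intro sum.cong) (auto simp: entry simp del: index_mult_mat(1))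
  also have "\<dots> = (\<Sum>j<n. \<Sum>i<n. B $$ (j, i) * A $$ (i, j))"
    by (subst sum.swap) (simp add: mult.commute)
  also have "\<dots> = mat_trace (B * A)"
    using assms unfolding mat_trace_def by (intro sum.cong) (auto simp: entry simp del: index_mult_mat(1))
  finally show ?thesis .
qed

lemma similar_mat_wit_trace:
  assumes "A \<in> carrier_mat n n" "similar_mat_wit A B P Q"
  shows "mat_trace A = mat_trace B"
proof -
  note w = similar_mat_witD2[OF assms]
  have "mat_trace A = mat_trace (P * (B * Q))"
    using w by (simp add: assoc_mult_mat[of P n n B n Q n])
  also have "\<dots> = mat_trace (B * Q * P)"
    using w by (intro mat_trace_mult_commute[of _ n]) auto
  also have "B * Q * P = B"
    using w by (simp add: assoc_mult_mat[of B n n Q n P n])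
  finally show ?thesis .
qed

lemma upper_triangular_pow:
  fixes T :: "'a::comm_ring_1 mat"
  assumes T: "T \<in> carrier_mat n n" and ut: "upper_triangular T"
  shows "upper_triangular (T ^\<^sub>m k) \<and> (\<forall>i<n. (T ^\<^sub>m k) $$ (i, i) = (T $$ (i, i)) ^ k)"
proof (induction k)
  case 0
  then show ?case using T by auto
next
  case (Suc k)
  let ?P = "T ^\<^sub>m k"
  have P: "?P \<in> carrier_mat n n" using T by auto
  have entry: "(?P * T) $$ (i, j) = (\<Sum>l<n. ?P $$ (i, l) * T $$ (l, j))" if "i < n" "j < n" for i j
    using that P T by (auto simp: scalar_prod_def lessThan_atLeast0)
  have z: "?P $$ (i, l) * T $$ (l, j) = 0" if "i < n" "l < n" "l < i \<or> j < l" for i j l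
    using that Suc ut P T by (auto dest: upper_triangularD)
  show ?case
  proof (intro conjI allI impI)
    show "upper_triangular (T ^\<^sub>m Suc k)"
    proof (rule upper_triangularI)
      fix i j assume "j < i" "i < dim_row (T ^\<^sub>m Suc k)"
      then have "j < i" "i < n" "j < n" using T by auto
      then show "(T ^\<^sub>m Suc k) $$ (i, j) = 0"
        using z[of i _ j] by (auto simp: entry simp del: index_mult_mat(1) intro!: sum.neutral)
          (metis linorder_not_le order_less_le_trans)
    qed
    fix i assume i: "i < n"
    have "(\<Sum>l<n. ?P $$ (i, l) * T $$ (l, i)) = (\<Sum>l\<in>{i}. ?P $$ (i, l) * T $$ (l, i))"
      by (intro sum.mono_neutral_right) (use i z[of i _ i] in \<open>auto simp: neq_iff\<close>)
    then show "(T ^\<^sub>m Suc k) $$ (i, i) = T $$ (i, i) ^ Suc k"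
      using i Suc by (simp add: entry del: index_mult_mat(1))
  qed
qed

text \<open>
  By Schur triangulation the matrix is similar to a triangular one with the roots of the
  characteristic polynomial on the diagonal, so that multiplicities are counted correctly.
\<close>
lemma mat_trace_pow_eigenvalues:
  fixes A :: "real mat"
  assumes A: "A \<in> carrier_mat n n"
    and split: "char_poly A = (\<Prod>e\<leftarrow>es. [:- e, 1:])"
  shows "mat_trace (A ^\<^sub>m k) = (\<Sum>e\<leftarrow>es. e ^ k)"
proof -
  obtain B P Q where d: "schur_decomposition A es = (B, P, Q)" by (metis prod_cases3)
  from schur_decomposition[OF A split d] have
    sim: "similar_mat_wit A B P Q" and ut: "upper_triangular B" and dg: "diag_mat B = es" by auto
  have B: "B \<in> carrier_mat n n" using similar_mat_witD2[OF A sim] by auto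
  have "mat_trace (A ^\<^sub>m k) = mat_trace (B ^\<^sub>m k)"
    by (rule similar_mat_wit_trace[OF _ similar_mat_wit_pow[OF sim]]) (use A in auto)
  also have "\<dots> = (\<Sum>i<n. (B $$ (i, i)) ^ k)"
    using B upper_triangular_pow[OF B ut] by (simp add: mat_trace_def)
  also have "\<dots> = (\<Sum>e\<leftarrow>diag_mat B. e ^ k)"
    using B by (simp add: diag_mat_def interv_sum_list_conv_sum_set_nat lessThan_atLeast0 o_def)
  finally show ?thesis using dg by simp
qed

text \<open>
  For an eigenvector \<open>v\<close> the Hermitian form \<open>v\<^sup>* A v = a |v|\<^sup>2\<close> is its own conjugate.
\<close>
lemma symmetric_complex_eigenvalue_real:
  fixes A :: "real mat"
  assumes A: "A \<in> carrier_mat n n" and sym: "\<And>i j. i < n \<Longrightarrow> j < n \<Longrightarrow> A $$ (i, j) = A $$ (j, i)"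
    and ev: "eigenvalue (map_mat complex_of_real A) a"
  shows "a \<in> \<real>"
proof -
  let ?A = "map_mat complex_of_real A"
  from ev obtain v where v: "v \<in> carrier_vec n" "v \<noteq> 0\<^sub>v n" "?A *\<^sub>v v = a \<cdot>\<^sub>v v"
    using A unfolding eigenvalue_def eigenvector_def by auto
  define N where "N = (\<Sum>i<n. (cmod (v $ i))\<^sup>2)"
  have row: "(\<Sum>j<n. complex_of_real (A $$ (i, j)) * v $ j) = a * v $ i" if "i < n" for i
  proof -
    have "(?A *\<^sub>v v) $ i = (\<Sum>j<n. complex_of_real (A $$ (i, j)) * v $ j)"
      using that A v(1) by (auto simp: scalar_prod_def lessThan_atLeast0)
    then show ?thesis using v(1,3) that by simp
  qed
  define s where "s = (\<Sum>i<n. cnj (v $ i) * (\<Sum>j<n. complex_of_real (A $$ (i, j)) * v $ j))"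
  have s1: "s = a * complex_of_real N"
  proof -
    have "s = (\<Sum>i<n. cnj (v $ i) * (a * v $ i))"
      unfolding s_def by (intro sum.cong refl) (simp add: row)
    then show ?thesis
      by (simp add: N_def sum_distrib_left complex_norm_square mult_ac del: of_real_power)
  qed
  have "cnj s = (\<Sum>i<n. \<Sum>j<n. cnj (v $ j) * (complex_of_real (A $$ (i, j)) * v $ i))"
    by (simp add: s_def sum_distrib_left mult_ac)
  also have "\<dots> = (\<Sum>j<n. \<Sum>i<n. cnj (v $ j) * (complex_of_real (A $$ (i, j)) * v $ i))"
    by (rule sum.swap)
  also have "\<dots> = s"
    unfolding s_def sum_distrib_left by (intro sum.cong refl) (auto simp: sym)
  finally have "cnj a * N = a * N" using s1 by simp
  moreover have "N \<noteq> 0"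
  proof
    assume "N = 0"
    then have "\<forall>i<n. v $ i = 0" unfolding N_def by (subst (asm) sum_nonneg_eq_0_iff) auto
    then have "v = 0\<^sub>v n" using v(1) by (intro eq_vecI) auto
    then show False using v(2) by simp
  qed
  ultimately have "cnj a = a" by simp
  then show ?thesis by (simp add: Reals_cnj_iff)
qed

lemma symmetric_char_poly_splits:
  fixes A :: "real mat"
  assumes A: "A \<in> carrier_mat n n" and sym: "\<And>i j. i < n \<Longrightarrow> j < n \<Longrightarrow> A $$ (i, j) = A $$ (j, i)"
  obtains es where "char_poly A = (\<Prod>e\<leftarrow>es. [:- e, 1:])" "length es = n"
proof -
  let ?A = "map_mat complex_of_real A"
  have cA: "?A \<in> carrier_mat n n" using A by auto
  from char_poly_factorized[OF cA] obtain as where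
    as: "char_poly ?A = (\<Prod>a\<leftarrow>as. [:- a, 1:])" "length as = n" by auto
  have re: "a \<in> \<real>" if "a \<in> set as" for a
  proof (rule symmetric_complex_eigenvalue_real[OF A sym])
    show "eigenvalue ?A a"
      using that unfolding eigenvalue_root_char_poly[OF cA] as(1)
      by (auto simp: poly_prod_list prod_list_zero_iff image_iff intro!: bexI[of _ a])
  qed auto
  define es where "es = map Re as"
  have eq: "as = map complex_of_real es"
    unfolding es_def map_map using re by (induction as) auto
  have "map_poly complex_of_real (char_poly A) = (\<Prod>a\<leftarrow>as. [:- a, 1:])"
    using of_real_hom.char_poly_hom[OF A, where 'a = complex] as(1) by simp
  also have "\<dots> = map_poly complex_of_real (\<Prod>e\<leftarrow>es. [:- e, 1:])"
  proof -
    interpret h: map_poly_comm_ring_hom "of_real :: real \<Rightarrow> complex" ..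
    show ?thesis unfolding eq by (simp add: h.hom_prod_list o_def)
  qed
  finally have mp: "map_poly complex_of_real (char_poly A) = map_poly complex_of_real (\<Prod>e\<leftarrow>es. [:- e, 1:])" .
  have "char_poly A = (\<Prod>e\<leftarrow>es. [:- e, 1:])"
  proof (rule poly_eqI)
    fix k
    show "coeff (char_poly A) k = coeff (\<Prod>e\<leftarrow>es. [:- e, 1:]) k"
      using arg_cong[OF mp, of "\<lambda>p. coeff p k"] by (simp add: coeff_map_poly)
  qed
  moreover have "length es = n" using as(2) by (simp add: es_def)
  ultimately show thesis using that by blast
qed


section \<open>The second eigenvalue as an operator norm\<close>

text \<open>
  The constant disappears after taking roots. Exponents that are powers of two suffice, and
  they are the ones reached by repeated doubling below.
\<close>
lemma le_if_powers_of_two_le: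
  fixes x y C :: real
  assumes "y \<ge> 0" and le: "\<And>j. x ^ (2 ^ j) \<le> C * y ^ (2 ^ j)"
  shows "x \<le> y"
proof (rule ccontr)
  assume "\<not> x \<le> y"
  then have xy: "y < x" "0 < x" using assms(1) by auto
  have C: "C > 0"
  proof (rule ccontr)
    assume "\<not> C > 0"
    then have "C * y \<le> 0" using assms(1) by (simp add: mult_nonpos_nonneg)
    then show False using le[of 0] xy by simp
  qed
  have y: "y > 0"
    using le[of 0] xy assms(1) by (cases "y = 0") auto
  obtain j where j: "C < (x / y) ^ j"
    using real_arch_pow[of "x / y" C] xy y by auto
  have "(x / y) ^ j \<le> (x / y) ^ (2 ^ j)"
    using xy y by (intro power_increasing) (auto intro: less_imp_le[OF less_exp])
  also have "\<dots> \<le> C" using le[of j] y by (simp add: power_divide pos_divide_le_eq)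
  finally show False using j by linarith
qed

text \<open>
  The trace method. Let \<open>x\<close> be orthogonal to the constant vector. The rows of \<open>A\<^sup>m\<close> sum to
  \<open>c\<^sup>m\<close>, and subtracting \<open>c\<^sup>m/n\<close> from every entry changes nothing in \<open>A\<^sup>m x\<close>. Cauchy-Schwarz then
  gives \<open>|A\<^sup>m x|\<^sup>2 \<le> (tr A\<^bsup>2m\<^esup> - c\<^bsup>2m\<^esup>) |x|\<^sup>2 \<le> n l\<^bsup>2m\<^esup> |x|\<^sup>2\<close>, because the subtracted term cancels the
  contribution of the top eigenvalue to the trace. On the other hand
  \<open>|A\<^sup>m x|\<^sup>4 = \<langle>x, A\<^bsup>2m\<^esup> x\<rangle>\<^sup>2 \<le> |x|\<^sup>2 |A\<^bsup>2m\<^esup> x|\<^sup>2\<close>, so that \<open>(|A x| / |x|)\<^sup>m \<le> |A\<^sup>m x| / |x|\<close> along the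
  powers of two. The factor \<open>n\<close> is lost in the limit.
\<close>
lemma second_eigenvalue_operator_bound:
  fixes A :: "real mat" and f :: "nat \<Rightarrow> real"
  assumes A: "A \<in> carrier_mat n n" and n: "n > 0"
    and sym: "\<And>i j. i < n \<Longrightarrow> j < n \<Longrightarrow> A $$ (i, j) = A $$ (j, i)"
    and row: "\<And>i. i < n \<Longrightarrow> (\<Sum>j<n. A $$ (i, j)) = c"
    and split: "char_poly A = (\<Prod>e\<leftarrow>es. [:- e, 1:])" "length es = n"
    and e0: "\<bar>es ! 0\<bar> \<le> c"
    and l: "l \<ge> 0" "\<And>i. 0 < i \<Longrightarrow> i < n \<Longrightarrow> \<bar>es ! i\<bar> \<le> l"
    and f: "(\<Sum>i<n. f i) = 0"
  shows "(\<Sum>i<n. (\<Sum>j<n. A $$ (i, j) * f j)\<^sup>2) \<le> l\<^sup>2 * (\<Sum>i<n. (f i)\<^sup>2)"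
proof -
  define p where "p m i j = (A ^\<^sub>m m) $$ (i, j)" for m i j
  define g where "g m i = (\<Sum>j<n. p m i j * f j)" for m i
  define F where "F m = (\<Sum>i<n. (g m i)\<^sup>2)" for m
  have Am: "A ^\<^sub>m m \<in> carrier_mat n n" for m using A by auto
  have entry: "(X * Y) $$ (i, j) = (\<Sum>l<n. X $$ (i, l) * Y $$ (l, j))"
    if "X \<in> carrier_mat n n" "Y \<in> carrier_mat n n" "i < n" "j < n" for X Y :: "real mat" and i j
    using that by (auto simp: scalar_prod_def lessThan_atLeast0)
  have p0: "p 0 i j = (if i = j then 1 else 0)" if "i < n" "j < n" for i j
    using that A by (auto simp: p_def)
  have pSuc: "p (Suc m) i j = (\<Sum>l<n. p m i l * A $$ (l, j))" if "i < n" "j < n" for m i j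
    unfolding p_def using that entry[OF Am A] by simp
  have p1: "p (Suc 0) i j = A $$ (i, j)" if "i < n" "j < n" for i j
    using that A by (simp add: p_def)
  have padd: "p (m + k) i j = (\<Sum>l<n. p m i l * p k l j)" if "i < n" "j < n" for m k i j
    using that
  proof (induction k arbitrary: j)
    case 0
    have "(\<Sum>l<n. p m i l * p 0 l j) = (\<Sum>l<n. if l = j then p m i l else 0)"
      by (intro sum.cong) (use 0 p0 in auto)
    then show ?case using 0 by simp
  next
    case (Suc k)
    have "p (m + Suc k) i j = (\<Sum>t<n. (\<Sum>l<n. p m i l * p k l t) * A $$ (t, j))"
      using Suc by (simp add: pSuc)
    also have "\<dots> = (\<Sum>l<n. p m i l * (\<Sum>t<n. p k l t * A $$ (t, j)))"
      unfolding sum_distrib_left sum_distrib_right by (subst sum.swap) (simp add: mult.assoc)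
    also have "\<dots> = (\<Sum>l<n. p m i l * p (Suc k) l j)"
      using Suc by (intro sum.cong) (auto simp: pSuc)
    finally show ?case .
  qed
  have psym: "p m i j = p m j i" if "i < n" "j < n" for m i j
    using that
  proof (induction m arbitrary: i j)
    case 0
    then show ?case by (simp add: p0)
  next
    case (Suc m)
    have "p (Suc m) i j = (\<Sum>l<n. A $$ (j, l) * p m l i)"
      unfolding pSuc[OF Suc.prems] using Suc sym by (intro sum.cong) auto
    also have "\<dots> = p (1 + m) j i"
      using Suc.prems by (subst padd) (auto intro!: sum.cong simp: p1)
    finally show ?case by simp
  qed
  have prow: "(\<Sum>j<n. p m i j) = c ^ m" if "i < n" for m i
    using that
  proof (induction m)
    case 0
    then show ?case by (simp add: p0)
  next
    case (Suc m)
    have "(\<Sum>j<n. p (Suc m) i j) = (\<Sum>l<n. p m i l * (\<Sum>j<n. A $$ (l, j)))"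
      using Suc by (simp add: pSuc sum_distrib_left) (subst sum.swap, simp)
    also have "\<dots> = c ^ m * c" using Suc by (simp add: row sum_distrib_right[symmetric])
    finally show ?case by simp
  qed
  \<comment> \<open>by symmetry the squared Frobenius norm of \<open>A\<^sup>m\<close> is the trace of \<open>A\<^bsup>2m\<^esup>\<close>\<close>
  have tr: "(\<Sum>i<n. \<Sum>j<n. (p m i j)\<^sup>2) = (\<Sum>i<n. (es ! i) ^ (2 * m))" for m
  proof -
    have "(\<Sum>i<n. \<Sum>j<n. (p m i j)\<^sup>2) = (\<Sum>i<n. p (m + m) i i)"
      by (intro sum.cong refl, subst padd) (auto intro!: sum.cong simp: power2_eq_square psym)
    also have "\<dots> = mat_trace (A ^\<^sub>m (2 * m))"
      using A by (simp add: mat_trace_def p_def mult_2)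
    also have "\<dots> = (\<Sum>e\<leftarrow>es. e ^ (2 * m))"
      by (rule mat_trace_pow_eigenvalues[OF A split(1)])
    finally show ?thesis
      using split(2) by (simp add: sum_list_sum_nth lessThan_atLeast0)
  qed
  have F0: "F 0 = (\<Sum>i<n. (f i)\<^sup>2)"
  proof -
    have "g 0 i = f i" if "i < n" for i
    proof -
      have "g 0 i = (\<Sum>j<n. if i = j then f j else 0)"
        unfolding g_def using that by (intro sum.cong) (auto simp: p0)
      then show ?thesis using that by simp
    qed
    then show ?thesis by (simp add: F_def)
  qed
  have F_nonneg: "F m \<ge> 0" for m by (simp add: F_def sum_nonneg)
  have F_trace: "F m \<le> real n * (l\<^sup>2) ^ m * F 0" for m
  proof -
    \<comment> \<open>the mean of each row, invisible to \<open>f\<close>\<close>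
    define b where "b = c ^ m / n"
    have "(g m i)\<^sup>2 \<le> (\<Sum>j<n. (p m i j - b)\<^sup>2) * F 0" if "i < n" for i
    proof -
      have "g m i = (\<Sum>j<n. (p m i j - b) * f j)"
        using f by (simp add: g_def left_diff_distrib sum_subtractf sum_distrib_left[symmetric])
      then show ?thesis
        unfolding F0 by (simp add: Cauchy_Schwarz_ineq_sum)
    qed
    then have "F m \<le> (\<Sum>i<n. (\<Sum>j<n. (p m i j - b)\<^sup>2) * F 0)"
      unfolding F_def[of m] by (intro sum_mono) auto
    also have "\<dots> = (\<Sum>i<n. \<Sum>j<n. (p m i j - b)\<^sup>2) * F 0"
      by (simp add: sum_distrib_right)
    also have "(\<Sum>i<n. \<Sum>j<n. (p m i j - b)\<^sup>2) =
        (\<Sum>i<n. \<Sum>j<n. (p m i j)\<^sup>2) - 2 * b * (\<Sum>i<n. \<Sum>j<n. p m i j) + real n * real n * b\<^sup>2"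
      by (simp add: power2_diff sum.distrib sum_subtractf sum_distrib_left mult_ac)
    also have "\<dots> = (\<Sum>i<n. (es ! i) ^ (2 * m)) - c ^ (2 * m)"
    proof -
      have nb: "real n * b = c ^ m" using n by (simp add: b_def)
      have "2 * b * (\<Sum>i<n. \<Sum>j<n. p m i j) = 2 * (real n * b * c ^ m)"
        by (simp add: prow)
      moreover have "real n * real n * b\<^sup>2 = real n * b * (real n * b)"
        by (simp add: power2_eq_square)
      moreover have "c ^ (2 * m) = c ^ m * c ^ m"
        by (metis mult_2 power_add)
      ultimately show ?thesis
        unfolding tr nb by linarith
    qed
    also have "(\<Sum>i<n. (es ! i) ^ (2 * m)) = (es ! 0) ^ (2 * m) + (\<Sum>i\<in>{1..<n}. (es ! i) ^ (2 * m))"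
      using n by (simp add: lessThan_atLeast0 sum.atLeast_Suc_lessThan)
    also have "(es ! 0) ^ (2 * m) \<le> c ^ (2 * m)"
      using e0 power_mono[OF e0, of "2 * m"] by (simp add: power_even_abs)
    also have "(\<Sum>i\<in>{1..<n}. (es ! i) ^ (2 * m)) \<le> (\<Sum>i\<in>{1..<n}. (l\<^sup>2) ^ m)"
    proof (rule sum_mono)
      fix i assume "i \<in> {1..<n}"
      then have "\<bar>es ! i\<bar> ^ (2 * m) \<le> l ^ (2 * m)" by (intro power_mono l) auto
      then show "(es ! i) ^ (2 * m) \<le> (l\<^sup>2) ^ m" by (simp add: power_even_abs power_mult)
    qed
    also have "\<dots> \<le> real n * (l\<^sup>2) ^ m" by (auto intro!: mult_right_mono)
    finally show ?thesis using F_nonneg[of 0] by (simp add: mult_right_mono)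
  qed
  have F_double: "(F m)\<^sup>2 \<le> F 0 * F (2 * m)" for m
  proof -
    have "F m = (\<Sum>i<n. \<Sum>j<n. f j * (p m j i * g m i))"
      unfolding F_def power2_eq_square
      by (intro sum.cong refl, subst g_def) (auto simp: sum_distrib_right psym intro!: sum.cong)
    also have "\<dots> = (\<Sum>j<n. f j * (\<Sum>i<n. p m j i * g m i))"
      by (subst sum.swap) (simp add: sum_distrib_left)
    also have "\<dots> = (\<Sum>j<n. f j * g (2 * m) j)"
    proof (intro sum.cong refl)
      fix j assume "j \<in> {..<n}"
      then have "g (2 * m) j = (\<Sum>t<n. \<Sum>i<n. p m j i * p m i t * f t)"
        by (simp add: g_def mult_2 padd sum_distrib_right)
      also have "\<dots> = (\<Sum>i<n. p m j i * g m i)"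
        by (subst sum.swap) (simp add: g_def sum_distrib_left mult.assoc)
      finally show "f j * (\<Sum>i<n. p m j i * g m i) = f j * g (2 * m) j" by simp
    qed
    finally have "F m = (\<Sum>j<n. f j * g (2 * m) j)" .
    then show ?thesis
      unfolding F0 F_def[of "2 * m"] by (simp add: Cauchy_Schwarz_ineq_sum)
  qed
  have F1: "F 1 = (\<Sum>i<n. (\<Sum>j<n. A $$ (i, j) * f j)\<^sup>2)"
    by (simp add: F_def g_def p1)
  show ?thesis
  proof (cases "F 0 = 0")
    case True
    then show ?thesis using F_trace[of 1] F1 F0 by simp
  next
    case False
    then have pos: "F 0 > 0" using F_nonneg[of 0] by simp
    have step: "(F 1 / F 0) ^ (2 ^ j) \<le> F (2 ^ j) / F 0" for j
    proof (induction j)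
      case (Suc j)
      have "(F 1 / F 0) ^ (2 ^ Suc j) = ((F 1 / F 0) ^ (2 ^ j))\<^sup>2"
        by (simp only: power_Suc2 power_mult)
      also have "\<dots> \<le> (F (2 ^ j) / F 0)\<^sup>2"
        using Suc F_nonneg pos by (intro power_mono) auto
      also have "\<dots> \<le> F 0 * F (2 * 2 ^ j) / (F 0)\<^sup>2"
        using F_double[of "2 ^ j"] by (simp add: power_divide divide_right_mono)
      also have "\<dots> = F (2 ^ Suc j) / F 0"
        using pos by (simp add: power2_eq_square)
      finally show ?case .
    qed simp
    have "F 1 / F 0 \<le> l\<^sup>2"
    proof (rule le_if_powers_of_two_le[where C = "real n"])
      show "0 \<le> l\<^sup>2" by simp
      fix j
      have "F (2 ^ j) / F 0 \<le> real n * (l\<^sup>2) ^ (2 ^ j)"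
        using F_trace[of "2 ^ j"] pos by (simp only: pos_divide_le_eq)
      then show "(F 1 / F 0) ^ (2 ^ j) \<le> real n * (l\<^sup>2) ^ (2 ^ j)"
        by (rule order_trans[OF step])
    qed
    then have "F 1 \<le> l\<^sup>2 * F 0" using pos by (simp only: pos_divide_le_eq)
    then show ?thesis unfolding F0 F1 .
  qed
qed


section \<open>The spectral gap of a regular graph\<close>

definition neighbours :: "'a pair_pre_digraph \<Rightarrow> 'a \<Rightarrow> 'a set" where
  "neighbours G v = {w. (v, w) \<in> parcs G}"

lemma regular_graphD:
  assumes "regular_graph G d"
  shows "finite (pverts G)" "finite (parcs G)"
    "\<And>u v. (u, v) \<in> parcs G \<Longrightarrow> u \<in> pverts G \<and> v \<in> pverts G \<and> u \<noteq> v \<and> (v, u) \<in> parcs G"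
    "\<And>v. v \<in> pverts G \<Longrightarrow> card (neighbours G v) = d"
    "\<And>v. finite (neighbours G v)"
    "\<And>v. neighbours G v \<subseteq> pverts G"
proof -
  interpret pair_graph G using assms by (simp add: regular_graph_def)
  show fin: "finite (pverts G)" "finite (parcs G)" by auto
  show arc: "\<And>u v. (u, v) \<in> parcs G \<Longrightarrow> u \<in> pverts G \<and> v \<in> pverts G \<and> u \<noteq> v \<and> (v, u) \<in> parcs G"
    using in_arcsD1 in_arcsD2 no_loops' arcs_symmetric by blast
  then show sub: "\<And>v. neighbours G v \<subseteq> pverts G" by (auto simp: neighbours_def)
  then show "\<And>v. finite (neighbours G v)" using fin finite_subset by blast
  fix v assume "v \<in> pverts G"
  then have "out_degree G v = d" using assms by (simp add: regular_graph_def)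
  moreover have "out_arcs G v = Pair v ` neighbours G v"
    by (auto simp: out_arcs_def neighbours_def)
  ultimately show "card (neighbours G v) = d"
    by (simp add: out_degree_def card_image inj_on_def)
qed

text \<open>
  Compare both sides of \<open>A v = e v\<close> at a coordinate where \<open>v\<close> is largest in absolute value.
\<close>
lemma eigenvalue_abs_le_row_sum:
  fixes A :: "real mat"
  assumes A: "A \<in> carrier_mat n n" and ev: "eigenvalue A e"
    and row: "\<And>i. i < n \<Longrightarrow> (\<Sum>j<n. \<bar>A $$ (i, j)\<bar>) \<le> c"
  shows "\<bar>e\<bar> \<le> c"
proof -
  from ev obtain v where v: "v \<in> carrier_vec n" "v \<noteq> 0\<^sub>v n" "A *\<^sub>v v = e \<cdot>\<^sub>v v"
    using A unfolding eigenvalue_def eigenvector_def by auto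
  have n: "n > 0" using eigenvalue_imp_nonzero_dim[OF A ev] .
  obtain i where i: "i < n" "\<And>j. j < n \<Longrightarrow> \<bar>v $ j\<bar> \<le> \<bar>v $ i\<bar>"
  proof -
    have "\<exists>i\<in>{..<n}. Max ((\<lambda>j. \<bar>v $ j\<bar>) ` {..<n}) = \<bar>v $ i\<bar>"
      using Max_in[of "(\<lambda>j. \<bar>v $ j\<bar>) ` {..<n}"] n by blast
    then show ?thesis using that Max_ge[of "(\<lambda>j. \<bar>v $ j\<bar>) ` {..<n}"] by fastforce
  qed
  have pos: "\<bar>v $ i\<bar> > 0"
  proof (rule ccontr)
    assume "\<not> \<bar>v $ i\<bar> > 0"
    then have "v $ j = 0" if "j < n" for j using i(2)[OF that] by simp
    then have "v = 0\<^sub>v n" using v(1) by (intro eq_vecI) auto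
    then show False using v(2) by simp
  qed
  have "e * v $ i = (A *\<^sub>v v) $ i" using v(1,3) i(1) by simp
  also have "\<dots> = (\<Sum>j<n. A $$ (i, j) * v $ j)"
    using A v(1) i(1) by (auto simp: scalar_prod_def lessThan_atLeast0)
  finally have "\<bar>e\<bar> * \<bar>v $ i\<bar> \<le> (\<Sum>j<n. \<bar>A $$ (i, j)\<bar> * \<bar>v $ j\<bar>)"
    using sum_abs[of "\<lambda>j. A $$ (i, j) * v $ j" "{..<n}"] by (simp add: abs_mult)
  also have "\<dots> \<le> (\<Sum>j<n. \<bar>A $$ (i, j)\<bar> * \<bar>v $ i\<bar>)"
    by (intro sum_mono mult_left_mono i(2)) auto
  also have "\<dots> = (\<Sum>j<n. \<bar>A $$ (i, j)\<bar>) * \<bar>v $ i\<bar>" by (simp add: sum_distrib_right)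
  also have "\<dots> \<le> c * \<bar>v $ i\<bar>" using row[OF i(1)] by (intro mult_right_mono) auto
  finally show ?thesis using pos by simp
qed

lemma eigenvalue_list_splits_char_poly:
  assumes "adjacency_matrix G \<in> carrier_mat n n"
    and "\<And>i j. i < n \<Longrightarrow> j < n \<Longrightarrow> adjacency_matrix G $$ (i, j) = adjacency_matrix G $$ (j, i)"
  shows "char_poly (adjacency_matrix G) = (\<Prod>e\<leftarrow>eigenvalue_list G. [:- e, 1:])"
    and "length (eigenvalue_list G) = n"
    and "sorted (rev (eigenvalue_list G))"
proof -
  obtain es where es: "char_poly (adjacency_matrix G) = (\<Prod>e\<leftarrow>es. [:- e, 1:])" "length es = n"
    using symmetric_char_poly_splits[OF assms] by blast
  have "proots (\<Prod>e\<leftarrow>es. [:- e, 1:]) = mset es"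
  proof (induction es)
    case (Cons e es)
    have "(\<Prod>e\<leftarrow>es. [:- e, 1:]) \<noteq> 0" by (auto simp: prod_list_zero_iff)
    then have "proots ([:- e, 1:] * (\<Prod>e\<leftarrow>es. [:- e, 1:])) = proots [:- e, 1:] + mset es"
      using Cons by (subst proots_mult) auto
    then show ?case by simp
  qed simp
  then have mset: "mset (eigenvalue_list G) = mset es"
    by (simp add: eigenvalue_list_def es)
  have "(\<Prod>e\<leftarrow>eigenvalue_list G. [:- e, 1:]) = (\<Prod>e\<leftarrow>es. [:- e, 1:])"
    using mset by (metis mset_map prod_mset_prod_list)
  then show "char_poly (adjacency_matrix G) = (\<Prod>e\<leftarrow>eigenvalue_list G. [:- e, 1:])"
    using es by simp
  show "length (eigenvalue_list G) = n" using mset es(2) by (metis size_mset)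
  show "sorted (rev (eigenvalue_list G))" by (simp add: eigenvalue_list_def)
qed

text \<open>
  In the descending list of eigenvalues every entry but the first lies between \<open>\<lambda>\<^sub>1\<close> and
  \<open>\<lambda>\<^bsub>n-1\<^esub>\<close>, hence has absolute value at most \<open>\<lambda>\<close>, and the first one is at most the degree.
  These are the two inputs of the trace method.
\<close>
lemma ndlambda_spectral_gap:
  fixes G :: "'a::linorder pair_pre_digraph"
  assumes G: "ndlambda_graph G n d lam" and n: "n > 0"
    and f: "(\<Sum>v\<in>pverts G. f v) = 0"
  shows "lam \<ge> 0"
    and "(\<Sum>v\<in>pverts G. (\<Sum>w\<in>neighbours G v. f w)\<^sup>2) \<le> lam\<^sup>2 * (\<Sum>v\<in>pverts G. (f v)\<^sup>2)"
proof -
  from G have reg: "regular_graph G d" and card: "card (pverts G) = n"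
    and lam: "second_eigenvalue G = lam" by (auto simp: ndlambda_graph_def)
  note rg = regular_graphD[OF reg]
  show lam0: "lam \<ge> 0" using lam by (auto simp: second_eigenvalue_def)
  define vs where "vs = sorted_list_of_set (pverts G)"
  define A where "A = adjacency_matrix G"
  have vs: "distinct vs" "set vs = pverts G" "length vs = n"
    using rg(1) card by (auto simp: vs_def)
  have bij: "bij_betw (\<lambda>i. vs ! i) {..<n} (pverts G)"
    using bij_betw_nth[OF vs(1) _ vs(2)[symmetric]] vs(3) by auto
  have Acar: "A \<in> carrier_mat n n"
    using vs(3) by (simp add: A_def adjacency_matrix_def vs_def Let_def)
  have Aij: "A $$ (i, j) = (if vs ! j \<in> neighbours G (vs ! i) then 1 else 0)" if "i < n" "j < n" for i j
    using that vs(3) by (simp add: A_def adjacency_matrix_def vs_def[symmetric] Let_def neighbours_def)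
  have Asym: "A $$ (i, j) = A $$ (j, i)" if "i < n" "j < n" for i j
    using that rg(3) by (auto simp: Aij neighbours_def)
  have Asum: "(\<Sum>j<n. A $$ (i, j) * h (vs ! j)) = (\<Sum>w\<in>neighbours G (vs ! i). h w)"
    if "i < n" for i and h :: "'a \<Rightarrow> real"
  proof -
    have "(\<Sum>j<n. A $$ (i, j) * h (vs ! j)) =
        (\<Sum>j<n. if vs ! j \<in> neighbours G (vs ! i) then h (vs ! j) else 0)"
      using that by (intro sum.cong) (auto simp: Aij)
    also have "\<dots> = (\<Sum>w\<in>pverts G. if w \<in> neighbours G (vs ! i) then h w else 0)"
      by (rule sum.reindex_bij_betw[OF bij])
    also have "\<dots> = (\<Sum>w\<in>neighbours G (vs ! i). h w)"
      using rg(1) rg(6)[of "vs ! i"] by (simp add: sum.If_cases Int_absorb1)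
    finally show ?thesis .
  qed
  have Vi: "vs ! i \<in> pverts G" if "i < n" for i using that vs by (metis nth_mem)
  have row: "(\<Sum>j<n. A $$ (i, j)) = real d" if "i < n" for i
    using Asum[OF that, of "\<lambda>_. 1"] rg(4)[OF Vi[OF that]] by simp
  define es where "es = eigenvalue_list G"
  have ev: "char_poly A = (\<Prod>e\<leftarrow>es. [:- e, 1:])" "length es = n" "sorted (rev es)"
  proof -
    have "adjacency_matrix G \<in> carrier_mat n n"
      and "\<And>i j. i < n \<Longrightarrow> j < n \<Longrightarrow> adjacency_matrix G $$ (i, j) = adjacency_matrix G $$ (j, i)"
      using Acar Asym by (simp_all add: A_def)
    from eigenvalue_list_splits_char_poly[OF this] show "char_poly A = (\<Prod>e\<leftarrow>es. [:- e, 1:])"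
      "length es = n" "sorted (rev es)"
      by (simp_all add: A_def es_def)
  qed
  have e0: "\<bar>es ! 0\<bar> \<le> real d"
  proof (rule eigenvalue_abs_le_row_sum[OF Acar])
    have "es ! 0 \<in> set es" using ev(2) n by simp
    then show "eigenvalue A (es ! 0)"
      unfolding eigenvalue_root_char_poly[OF Acar] ev(1)
      by (auto simp: poly_prod_list prod_list_zero_iff image_iff intro!: bexI[of _ "es ! 0"])
    fix i assume i: "i < n"
    have "(\<Sum>j<n. \<bar>A $$ (i, j)\<bar>) = (\<Sum>j<n. A $$ (i, j))"
      using i by (intro sum.cong) (auto simp: Aij)
    then show "(\<Sum>j<n. \<bar>A $$ (i, j)\<bar>) \<le> real d" using row[OF i] by simp
  qed
  have mono: "es ! j \<le> es ! i" if "i \<le> j" "j < n" for i j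
    using ev(2,3) that by (simp add: sorted_rev_iff_nth_mono)
  have l: "\<bar>es ! i\<bar> \<le> lam" if "0 < i" "i < n" for i
  proof -
    have "es ! i \<le> es ! 1" "es ! (n - 1) \<le> es ! i"
      using mono[of 1 i] mono[of i "n - 1"] that by auto
    moreover have "lam = max \<bar>es ! 1\<bar> \<bar>es ! (n - 1)\<bar>"
      using lam by (simp add: second_eigenvalue_def es_def card)
    ultimately show ?thesis by linarith
  qed
  have "(\<Sum>i<n. (\<Sum>j<n. A $$ (i, j) * f (vs ! j))\<^sup>2) \<le> lam\<^sup>2 * (\<Sum>i<n. (f (vs ! i))\<^sup>2)"
  proof (rule second_eigenvalue_operator_bound[OF Acar n Asym row ev(1) ev(2) e0 lam0 l])
    show "(\<Sum>i<n. f (vs ! i)) = 0" using f sum.reindex_bij_betw[OF bij, of f] by simp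
  qed
  then show "(\<Sum>v\<in>pverts G. (\<Sum>w\<in>neighbours G v. f w)\<^sup>2) \<le> lam\<^sup>2 * (\<Sum>v\<in>pverts G. (f v)\<^sup>2)"
    using sum.reindex_bij_betw[OF bij, of "\<lambda>v. (f v)\<^sup>2"]
      sum.reindex_bij_betw[OF bij, of "\<lambda>v. (\<Sum>w\<in>neighbours G v. f w)\<^sup>2"] Asum
    by simp
qed


section \<open>Expansion of large sets\<close>

definition outer_boundary :: "'a pair_pre_digraph \<Rightarrow> 'a set \<Rightarrow> 'a set" where
  "outer_boundary G U = (\<Union>u\<in>U. neighbours G u) - U"

lemma sum_over_neighbours:
  fixes h :: "'a \<Rightarrow> real"
  assumes reg: "regular_graph G d"
  shows "(\<Sum>v\<in>pverts G. \<Sum>w\<in>neighbours G v. h w) = d * (\<Sum>w\<in>pverts G. h w)"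
proof -
  note rg = regular_graphD[OF reg]
  have "(\<Sum>v\<in>pverts G. \<Sum>w\<in>neighbours G v. h w) =
      (\<Sum>v\<in>pverts G. \<Sum>w | w \<in> pverts G \<and> (v, w) \<in> parcs G. h w)"
    by (intro sum.cong) (use rg(3) in \<open>auto simp: neighbours_def\<close>)
  also have "\<dots> = (\<Sum>w\<in>pverts G. \<Sum>v | v \<in> pverts G \<and> (v, w) \<in> parcs G. h w)"
    using rg(1) by (intro sum.swap_restrict)
  also have "\<dots> = (\<Sum>w\<in>pverts G. \<Sum>v\<in>neighbours G w. h w)"
    by (intro sum.cong) (use rg(3) in \<open>auto simp: neighbours_def\<close>)
  also have "\<dots> = d * (\<Sum>w\<in>pverts G. h w)"
    using rg(4) by (simp add: sum_distrib_left)
  finally show ?thesis .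
qed

text \<open>
  Tanner's inequality. Apply the spectral gap to the indicator of \<open>U\<close> minus its mean: this bounds
  the sum of the squares of \<open>D v\<close>, the number of neighbours of \<open>v\<close> in \<open>U\<close>. The sum of \<open>D\<close> is
  \<open>d |U|\<close> and \<open>D\<close> lives on the neighbourhood of \<open>U\<close>, which therefore is large by Cauchy-Schwarz.
\<close>
lemma neighbourhood_expansion:
  fixes G :: "'a::linorder pair_pre_digraph"
  assumes G: "ndlambda_graph G n d lam" and U: "U \<subseteq> pverts G" "U \<noteq> {}" and L: "lam \<le> L"
  shows "real d ^ 2 * card U \<le>
     (real (card U) + card (outer_boundary G U)) * (L\<^sup>2 + (real d ^ 2 - L\<^sup>2) * (card U / n))"
proof -
  from G have reg: "regular_graph G d" and card: "card (pverts G) = n"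
    by (auto simp: ndlambda_graph_def)
  note rg = regular_graphD[OF reg]
  have finU: "finite U" using U(1) rg(1) by (rule finite_subset)
  define k where "k = real (card U)"
  have k: "k > 0" using U(2) finU by (simp add: k_def card_gt_0_iff)
  have kn: "k \<le> n" using card_mono[OF rg(1) U(1)] card by (simp add: k_def)
  have n: "n > 0" using k kn by simp
  define \<Gamma> where "\<Gamma> = (\<Union>u\<in>U. neighbours G u)"
  have \<Gamma>: "\<Gamma> \<subseteq> pverts G" "finite \<Gamma>" using finU rg(5,6) by (auto simp: \<Gamma>_def)
  have card\<Gamma>: "real (card \<Gamma>) \<le> k + card (outer_boundary G U)"
  proof -
    have "card \<Gamma> \<le> card (U \<union> outer_boundary G U)"
      by (rule card_mono) (use finU \<Gamma> in \<open>auto simp: outer_boundary_def \<Gamma>_def\<close>)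
    also have "\<dots> \<le> card U + card (outer_boundary G U)" by (rule card_Un_le)
    finally show ?thesis by (simp add: k_def)
  qed
  define D where "D v = (\<Sum>w\<in>neighbours G v. indicator U w :: real)" for v
  have sumU: "(\<Sum>v\<in>pverts G. indicator U v :: real) = k"
  proof -
    have "(\<Sum>v\<in>pverts G. indicator U v :: real) = (\<Sum>v\<in>U. 1)"
      by (intro sum.mono_neutral_cong_right) (use rg(1) U(1) in auto)
    then show ?thesis by (simp add: k_def)
  qed
  have sumD: "(\<Sum>v\<in>pverts G. D v) = d * k"
    unfolding D_def sum_over_neighbours[OF reg] sumU by simp
  define f where "f v = indicator U v - k / n" for v
  have sumf: "(\<Sum>v\<in>pverts G. f v) = 0"
    using n by (simp add: f_def sum_subtractf sumU card)
  have "(\<Sum>v\<in>pverts G. (f v)\<^sup>2) = (\<Sum>v\<in>pverts G. indicator U v * (1 - 2 * (k / n)) + (k / n)\<^sup>2)"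
    by (intro sum.cong) (auto simp: f_def indicator_def power2_eq_square algebra_simps)
  also have "\<dots> = k * (1 - 2 * (k / n)) + n * (k / n)\<^sup>2"
    by (simp add: sum.distrib sum_distrib_right[symmetric] sumU card)
  also have "\<dots> = k * (1 - k / n)"
    using n by (simp add: power2_eq_square field_simps)
  finally have sumf2: "(\<Sum>v\<in>pverts G. (f v)\<^sup>2) = k * (1 - k / n)" .
  have nf: "(\<Sum>w\<in>neighbours G v. f w) = D v - d * (k / n)" if "v \<in> pverts G" for v
    using rg(4)[OF that] by (simp add: f_def D_def sum_subtractf)
  have "(\<Sum>v\<in>pverts G. (\<Sum>w\<in>neighbours G v. f w)\<^sup>2) =
      (\<Sum>v\<in>pverts G. (D v)\<^sup>2 - 2 * (d * (k / n)) * D v + (d * (k / n))\<^sup>2)"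
    by (intro sum.cong) (auto simp: nf power2_diff algebra_simps)
  also have "\<dots> = (\<Sum>v\<in>pverts G. (D v)\<^sup>2) - 2 * (d * (k / n)) * (d * k) + n * (d * (k / n))\<^sup>2"
    unfolding sum.distrib sum_subtractf sum_distrib_left[symmetric] sumD by (simp add: card)
  also have "\<dots> = (\<Sum>v\<in>pverts G. (D v)\<^sup>2) - real d ^ 2 * k * (k / n)"
    using n by (simp add: power2_eq_square field_simps)
  finally have "(\<Sum>v\<in>pverts G. (D v)\<^sup>2) - real d ^ 2 * k * (k / n) \<le> lam\<^sup>2 * (k * (1 - k / n))"
    using ndlambda_spectral_gap(2)[OF G n sumf] sumf2 by simp
  also have "\<dots> \<le> L\<^sup>2 * (k * (1 - k / n))"
    using ndlambda_spectral_gap(1)[OF G n sumf] L k kn n by (intro mult_right_mono power_mono) auto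
  finally have D2: "(\<Sum>v\<in>pverts G. (D v)\<^sup>2) \<le> k * (L\<^sup>2 + (real d ^ 2 - L\<^sup>2) * (k / n))"
    by (simp add: algebra_simps)
  have Dz: "D v = 0" if "v \<notin> \<Gamma>" for v
    unfolding D_def
  proof (rule sum.neutral, rule ballI)
    fix w assume "w \<in> neighbours G v"
    then have "w \<notin> U" using that rg(3) by (auto simp: \<Gamma>_def neighbours_def)
    then show "indicator U w = (0::real)" by simp
  qed
  have "(\<Sum>v\<in>\<Gamma>. D v) = (\<Sum>v\<in>pverts G. D v)" "(\<Sum>v\<in>\<Gamma>. (D v)\<^sup>2) = (\<Sum>v\<in>pverts G. (D v)\<^sup>2)"
    by (intro sum.mono_neutral_left; use \<Gamma> rg(1) Dz in auto)+
  then have "(d * k)\<^sup>2 \<le> (\<Sum>v\<in>pverts G. (D v)\<^sup>2) * card \<Gamma>"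
    using Cauchy_Schwarz_ineq_sum[of D "\<lambda>_. 1" \<Gamma>] by (simp add: sumD)
  also have "\<dots> \<le> k * (L\<^sup>2 + (real d ^ 2 - L\<^sup>2) * (k / n)) * (k + card (outer_boundary G U))"
    using D2 card\<Gamma> by (intro mult_mono order_trans[OF _ D2]) (auto simp: sum_nonneg)
  finally have "k * (real d ^ 2 * k) \<le> k * ((k + card (outer_boundary G U)) * (L\<^sup>2 + (real d ^ 2 - L\<^sup>2) * (k / n)))"
    by (simp add: power2_eq_square mult_ac)
  then show ?thesis using k unfolding k_def[symmetric] by (simp only: mult_le_cancel_left_pos)
qed

text \<open>
  Sets of size at most \<open>\<epsilon> n\<close> have boundary at least \<open>(d - 1)/20\<close> times their size, which at
  size 40 is exactly \<open>2 (d - 1)\<close>. For larger sets a weaker expansion factor \<open>c'\<close> is enough, since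
  half of \<open>c' |U| \<ge> c' \<epsilon> n\<close> exceeds the constant \<open>2 (d - 1)\<close> once \<open>n\<close> is large.
\<close>
lemma large_set_expansion:
  fixes L :: real
  assumes d: "d \<ge> 2" and L: "(real d + 19) * L\<^sup>2 < 20 * real d ^ 2"
  obtains c :: real and n0 :: nat where "c > 0"
    "\<And>(G :: 'a::linorder pair_pre_digraph) n lam U.
       n \<ge> n0 \<Longrightarrow> ndlambda_graph G n d lam \<Longrightarrow> lam \<le> L \<Longrightarrow> U \<subseteq> pverts G \<Longrightarrow>
       40 \<le> card U \<Longrightarrow> 2 * card U \<le> n \<Longrightarrow>
       2 * (real d - 1) + c * (real (card U) - 40) \<le> card (outer_boundary G U)"
proof -
  have d2: "real d ^ 2 > 0" using d by simp
  have Ld: "L\<^sup>2 < real d ^ 2"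
  proof -
    have "20 * L\<^sup>2 \<le> (real d + 19) * L\<^sup>2" using d by (intro mult_right_mono) auto
    then show ?thesis using L by linarith
  qed
  \<comment> \<open>the largest \<open>\<epsilon>\<close> with \<open>(d + 19) (L\<^sup>2 + d\<^sup>2 \<epsilon>) \<le> 20 d\<^sup>2\<close>\<close>
  define \<epsilon> where "\<epsilon> = (20 * real d ^ 2 - (real d + 19) * L\<^sup>2) / ((real d + 19) * real d ^ 2)"
  have \<epsilon>: "\<epsilon> > 0" unfolding \<epsilon>_def using L d2 by (intro divide_pos_pos) auto
  have eps_eq: "L\<^sup>2 + real d ^ 2 * \<epsilon> = 20 * real d ^ 2 / (real d + 19)"
  proof -
    have "real d ^ 2 * \<epsilon> = (20 * real d ^ 2 - (real d + 19) * L\<^sup>2) / (real d + 19)"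
      unfolding \<epsilon>_def using d2 by simp
    also have "\<dots> = 20 * real d ^ 2 / (real d + 19) - L\<^sup>2"
      using d by (simp add: diff_divide_distrib)
    finally show ?thesis by simp
  qed
  \<comment> \<open>the expansion factor at \<open>|U| = n/2\<close>\<close>
  define c' where "c' = (real d ^ 2 - L\<^sup>2) / (real d ^ 2 + L\<^sup>2)"
  have c': "c' > 0" unfolding c'_def using Ld d2 by (intro divide_pos_pos add_pos_nonneg) auto
  define c where "c = min ((real d - 1) / 20) (c' / 2)"
  define n0 where "n0 = nat \<lceil>4 * (real d - 1) / (c' * \<epsilon>)\<rceil> + 1"
  show thesis
  proof (rule that[of c n0])
    show "c > 0" using c' d by (simp add: c_def)
    fix G :: "'a pair_pre_digraph" and n lam U
    assume n: "n \<ge> n0" and G: "ndlambda_graph G n d lam" and lam: "lam \<le> L"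
      and U: "U \<subseteq> pverts G" "40 \<le> card U" "2 * card U \<le> n"
    have "n > 0" using n by (simp add: n0_def)
    define k where "k = real (card U)"
    define b where "b = real (card (outer_boundary G U))"
    have k: "k \<ge> 40" "2 * k \<le> n" using U by (auto simp: k_def)
    have b: "b \<ge> 0" by (simp add: b_def)
    have "U \<noteq> {}" using U(2) by auto
    from neighbourhood_expansion[OF G U(1) this lam]
    have main: "real d ^ 2 * k \<le> (k + b) * (L\<^sup>2 + (real d ^ 2 - L\<^sup>2) * (k / n))"
      by (simp add: k_def b_def)
    have "2 * (real d - 1) + c * (k - 40) \<le> b"
    proof (cases "k \<le> \<epsilon> * n")
      case True
      then have "k / n \<le> \<epsilon>" using \<open>n > 0\<close> by (simp add: field_simps)
      then have "(real d ^ 2 - L\<^sup>2) * (k / n) \<le> real d ^ 2 * \<epsilon>"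
        using Ld k by (intro mult_mono) auto
      then have "(k + b) * (L\<^sup>2 + (real d ^ 2 - L\<^sup>2) * (k / n)) \<le> (k + b) * (20 * real d ^ 2 / (real d + 19))"
        unfolding eps_eq[symmetric] using k b by (intro mult_left_mono) auto
      also have "(k + b) * (20 * real d ^ 2 / (real d + 19)) = real d ^ 2 * ((k + b) * 20 / (real d + 19))"
        by (simp only: times_divide_eq_right mult_ac)
      finally have "real d ^ 2 * k \<le> real d ^ 2 * ((k + b) * 20 / (real d + 19))"
        using main by linarith
      then have "k \<le> (k + b) * 20 / (real d + 19)" using d2 by (simp only: mult_le_cancel_left_pos)
      then have "(real d - 1) / 20 * k \<le> b" using d by (simp add: field_simps)
      moreover have "c * (k - 40) \<le> (real d - 1) / 20 * (k - 40)"
        unfolding c_def using k by (intro mult_right_mono min.cobounded1) simp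
      ultimately show ?thesis by (simp add: algebra_simps)
    next
      case False
      have "(real d ^ 2 - L\<^sup>2) * (k / n) \<le> (real d ^ 2 - L\<^sup>2) * (1 / 2)"
        using Ld k \<open>n > 0\<close> by (intro mult_left_mono) (auto simp: field_simps)
      then have "(k + b) * (L\<^sup>2 + (real d ^ 2 - L\<^sup>2) * (k / n)) \<le> (k + b) * ((real d ^ 2 + L\<^sup>2) / 2)"
        using k b by (intro mult_left_mono) (auto simp: field_simps)
      with main have "real d ^ 2 * k \<le> (k + b) * ((real d ^ 2 + L\<^sup>2) / 2)" by linarith
      then have "(real d ^ 2 - L\<^sup>2) * k \<le> b * (real d ^ 2 + L\<^sup>2)" by (simp add: field_simps)
      then have bk: "c' * k \<le> b" 
        using d2 unfolding c'_def by (simp add: pos_divide_le_eq add_pos_nonneg)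
      have "4 * (real d - 1) / (c' * \<epsilon>) \<le> n" using n unfolding n0_def by linarith
      then have "4 * (real d - 1) \<le> c' * (\<epsilon> * n)" using c' \<epsilon> by (simp add: field_simps)
      also have "\<dots> \<le> c' * k" using False c' by (intro mult_left_mono) auto
      finally have "2 * (real d - 1) \<le> c' * k / 2" by simp
      moreover have "c * (k - 40) \<le> c' / 2 * k"
        using k c' d by (intro mult_mono) (auto simp: c_def)
      ultimately show ?thesis using bk by simp
    qed
    then show "2 * (real d - 1) + c * (real (card U) - 40) \<le> card (outer_boundary G U)"
      by (simp add: k_def b_def)
  qed
qed

text \<open>
  With \<open>t = d - 1\<close> this is a quadratic inequality in \<open>t\<close> with terms of lower order in \<open>\<surd>t\<close>. For
  \<open>d = 3\<close> it reads \<open>179.13 < 180\<close> (rounded up): this is the case that limits the allowance \<open>1/40\<close>.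
\<close>
lemma spectral_threshold:
  assumes d: "d \<ge> 3"
  shows "(real d + 19) * (2 * sqrt (real d - 1) + 1 / 40)\<^sup>2 < 20 * real d ^ 2"
proof -
  define t where "t = real d - 1"
  define s where "s = sqrt t"
  have t: "t \<ge> 2" using d by (simp add: t_def)
  have s2: "s * s = t" and s0: "s \<ge> 0" using t by (auto simp: s_def)
  \<comment> \<open>\<open>707/500\<close> is a rational just below \<open>\<surd>2\<close>\<close>
  have s1: "s \<ge> (707 / 500)"
    unfolding s_def using t by (intro real_le_rsqrt) (simp add: power2_eq_square)
  have st: "s \<le> (500 / 707) * t"
  proof -
    have "(707 / 500) * s \<le> s * s" using s1 s0 by (intro mult_right_mono) auto
    then show ?thesis using s2 t by simp
  qed
  have ts: "t * s \<le> t * ((500 / 707) * t)" using st t by (intro mult_left_mono) auto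
  \<comment> \<open>the tangent of the square at \<open>t = 2\<close>, where the inequality is closest to equality\<close>
  have tt: "t * t \<ge> 4 * t - 4"
    using zero_le_power2[of "t - 2"] by (simp add: power2_eq_square algebra_simps)
  have "(2 * s + 1 / 40)\<^sup>2 = 4 * t + s / 10 + 1 / 1600"
    by (simp add: power2_eq_square algebra_simps s2)
  then have "(t + 20) * (2 * s + 1 / 40)\<^sup>2 = (t + 20) * (4 * t + s / 10 + 1 / 1600)" by simp
  also have "\<dots> = 4 * (t * t) + (t * s) / 10 + (80 + 1 / 1600) * t + 2 * s + 1 / 80"
    by (simp add: field_simps)
  also have "\<dots> < 20 * (t + 1)\<^sup>2"
  proof -
    have "20 * (t + 1)\<^sup>2 = 20 * (t * t) + 40 * t + 20" by (simp add: power2_eq_square algebra_simps)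
    moreover have "t * s \<le> 500 / 707 * (t * t)" using ts by simp
    then have "4 * (t * t) + (t * s) / 10 + (80 + 1 / 1600) * t + 2 * s + 1 / 80 <
        20 * (t * t) + 40 * t + 20" using st tt t by argo
    ultimately show ?thesis by simp
  qed
  finally show ?thesis by (simp add: t_def s_def add_ac)
qed


section \<open>Expansion of small sets\<close>

definition triangles :: "'a pair_pre_digraph \<Rightarrow> 'a set set" where
  "triangles G =
     {T. T \<subseteq> pverts G \<and> card T = 3 \<and> (\<forall>u\<in>T. \<forall>v\<in>T. u \<noteq> v \<longrightarrow> (u, v) \<in> parcs G)}"

lemma card_edges_within_le_card:
  assumes fin: "finite (pverts G)" and dens: "max_density G M \<le> 1"
    and U: "U \<subseteq> pverts G" "U \<noteq> {}" "real (card U) \<le> M"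
  shows "card (edges_within G U) \<le> card U"
proof -
  let ?D = "{real (card (edges_within G U)) / real (card U) | U.
            U \<noteq> {} \<and> U \<subseteq> pverts G \<and> real (card U) \<le> M}"
  have "?D \<subseteq> (\<lambda>U. real (card (edges_within G U)) / real (card U)) ` Pow (pverts G)" by auto
  then have "finite ?D" by (rule finite_subset) (use fin in auto)
  moreover have "real (card (edges_within G U)) / real (card U) \<in> ?D" using U by auto
  ultimately have "real (card (edges_within G U)) / real (card U) \<le> max_density G M"
    unfolding max_density_def by (rule Max_ge)
  moreover have "card U > 0" using U fin by (simp add: card_gt_0_iff finite_subset)
  ultimately have "real (card (edges_within G U)) / real (card U) \<le> 1" "card U > 0"
    using dens by linarith+
  then show ?thesis by simp
qed

lemma finite_edges_within: "finite U \<Longrightarrow> finite (edges_within G U)"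
  by (rule finite_subset[of _ "Pow U"]) (auto simp: edges_within_def)

text \<open>
  Count the \<open>d |U|\<close> arcs leaving vertices of \<open>U\<close>: an edge inside \<open>U\<close> is counted twice, an edge
  to the boundary once.
\<close>
lemma degree_sum_le_edges:
  assumes reg: "regular_graph G d" and U: "U \<subseteq> pverts G"
  shows "d * card U \<le> card (edges_within G (U \<union> outer_boundary G U)) + card (edges_within G U)"
proof -
  note rg = regular_graphD[OF reg]
  have finU: "finite U" using U rg(1) by (rule finite_subset)
  have finW: "finite (U \<union> outer_boundary G U)" using finU rg(5) by (auto simp: outer_boundary_def)
  define A where "A = (SIGMA u:U. neighbours G u)"
  \<comment> \<open>arcs to the boundary and arcs inside \<open>U\<close>\<close>
  define A1 where "A1 = {e \<in> A. snd e \<notin> U}"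
  define A2 where "A2 = {e \<in> A. snd e \<in> U}"
  define E where "E = (\<lambda>e. {fst e, snd e}) ` A1"
  have finA: "finite A" using finU rg(5) by (auto simp: A_def)
  have "card A = (\<Sum>u\<in>U. card (neighbours G u))"
    unfolding A_def using finU rg(5) by (intro card_SigmaI) auto
  also have "\<dots> = (\<Sum>u\<in>U. d)" using U rg(4) by (intro sum.cong) auto
  finally have cardA: "card A = d * card U" by simp
  have "A = A1 \<union> A2" by (auto simp: A1_def A2_def)
  then have split: "card A \<le> card A1 + card A2" by (metis card_Un_le)
  have "inj_on (\<lambda>e. {fst e, snd e}) A1"
    by (rule inj_onI) (auto simp: A1_def A_def doubleton_eq_iff prod_eq_iff)
  then have cE: "card E = card A1" unfolding E_def by (rule card_image)
  have disj: "E \<inter> edges_within G U = {}"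
    by (auto simp: E_def A1_def A_def edges_within_def doubleton_eq_iff)
  have "E \<subseteq> edges_within G (U \<union> outer_boundary G U)"
  proof
    fix e assume "e \<in> E"
    then obtain u w where uw: "e = {u, w}" "u \<in> U" "w \<in> neighbours G u" "w \<notin> U"
      by (auto simp: E_def A1_def A_def)
    then have "(u, w) \<in> parcs G" "u \<in> U \<union> outer_boundary G U" "w \<in> U \<union> outer_boundary G U"
      by (auto simp: outer_boundary_def neighbours_def)
    then show "e \<in> edges_within G (U \<union> outer_boundary G U)"
      unfolding edges_within_def using uw(1) by blast
  qed
  then have "E \<union> edges_within G U \<subseteq> edges_within G (U \<union> outer_boundary G U)"
    by (auto simp: edges_within_def)
  then have "card (E \<union> edges_within G U) \<le> card (edges_within G (U \<union> outer_boundary G U))"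
    by (rule card_mono[OF finite_edges_within[OF finW]])
  moreover have "card (E \<union> edges_within G U) = card E + card (edges_within G U)"
    by (rule card_Un_disjoint[OF _ finite_edges_within[OF finU] disj])
      (use finA in \<open>auto simp: E_def A1_def\<close>)
  ultimately have e1: "card A1 + card (edges_within G U) \<le> card (edges_within G (U \<union> outer_boundary G U))"
    using cE by simp
  have "card A2 \<le> card (\<Union>e\<in>edges_within G U. {a. {fst a, snd a} = e})"
  proof (rule card_mono)
    have "finite {a :: 'a \<times> 'a. {fst a, snd a} = e}" if "e \<in> edges_within G U" for e
      by (rule finite_subset[of _ "U \<times> U"])
        (use that finU in \<open>auto simp: edges_within_def doubleton_eq_iff\<close>)
    then show "finite (\<Union>e\<in>edges_within G U. {a. {fst a, snd a} = e})"
      using finite_edges_within[OF finU] by auto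
    show "A2 \<subseteq> (\<Union>e\<in>edges_within G U. {a. {fst a, snd a} = e})"
      by (auto simp: A2_def A_def edges_within_def neighbours_def) blast
  qed
  also have "\<dots> \<le> (\<Sum>e\<in>edges_within G U. card {a. {fst a, snd a} = e})"
    by (rule card_UN_le[OF finite_edges_within[OF finU]])
  also have "\<dots> \<le> (\<Sum>e\<in>edges_within G U. 2)"
  proof (rule sum_mono)
    fix e assume "e \<in> edges_within G U"
    then obtain u v where "e = {u, v}" by (auto simp: edges_within_def)
    then have "{a. {fst a, snd a} = e} \<subseteq> {(u, v), (v, u)}" by (auto simp: doubleton_eq_iff)
    from card_mono[OF _ this] show "card {a. {fst a, snd a} = e} \<le> 2"
      by (simp add: card_insert_if split: if_splits)
  qed
  finally have "card A2 \<le> 2 * card (edges_within G U)" by simp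
  then show ?thesis using split e1 cardA by linarith
qed

lemma card_edges_within_le_choose:
  assumes reg: "regular_graph G d" and U: "finite U"
  shows "card (edges_within G U) \<le> card U choose 2"
    and "\<lbrakk>u \<in> U; v \<in> U; u \<noteq> v; (u, v) \<notin> parcs G\<rbrakk> \<Longrightarrow> card (edges_within G U) < card U choose 2"
proof -
  note rg = regular_graphD[OF reg]
  let ?P = "{e. e \<subseteq> U \<and> card e = 2}"
  have sub: "edges_within G U \<subseteq> ?P"
    using rg(3) by (auto simp: edges_within_def card_insert_if)
  have P: "finite ?P" "card ?P = card U choose 2"
    using U by (auto simp: n_subsets)
  show "card (edges_within G U) \<le> card U choose 2" using card_mono[OF P(1) sub] P(2) by simp
  assume uv: "u \<in> U" "v \<in> U" "u \<noteq> v" "(u, v) \<notin> parcs G"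
  then have "{u, v} \<in> ?P" "{u, v} \<notin> edges_within G U"
    using rg(3) by (auto simp: edges_within_def doubleton_eq_iff)
  then have "edges_within G U \<subset> ?P" using sub by blast
  then show "card (edges_within G U) < card U choose 2" using psubset_card_mono[OF P(1)] P(2) by metis
qed

text \<open>
  For a single edge the counting of edges loses one vertex; without a common neighbour the two
  neighbourhoods are disjoint and the boundary is known exactly.
\<close>
lemma triangle_free_edge_boundary:
  assumes reg: "regular_graph G d" and uv: "(u, v) \<in> parcs G"
    and no: "\<And>T. T \<in> triangles G \<Longrightarrow> \<not> {u, v} \<subseteq> T"
  shows "card (outer_boundary G {u, v}) = 2 * (d - 1)"
proof -
  note rg = regular_graphD[OF reg]
  have "neighbours G u \<inter> neighbours G v = {}"
  proof (rule ccontr)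
    assume "neighbours G u \<inter> neighbours G v \<noteq> {}"
    then obtain w where "(u, w) \<in> parcs G" "(v, w) \<in> parcs G" by (auto simp: neighbours_def)
    then have "{u, v, w} \<in> triangles G" using uv rg(3) by (auto simp: triangles_def card_insert_if)
    then show False using no by blast
  qed
  then have "card ((neighbours G u - {v}) \<union> (neighbours G v - {u})) =
      card (neighbours G u - {v}) + card (neighbours G v - {u})"
    using rg(5) by (intro card_Un_disjoint) auto
  moreover have "outer_boundary G {u, v} = (neighbours G u - {v}) \<union> (neighbours G v - {u})"
    using rg(3) by (auto simp: outer_boundary_def neighbours_def)
  moreover have "v \<in> neighbours G u" "u \<in> neighbours G v" "u \<in> pverts G" "v \<in> pverts G"
    using uv rg(3) by (auto simp: neighbours_def)
  ultimately show ?thesis using rg(4,5) by (simp add: card_Diff_singleton)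
qed

text \<open>
  Let \<open>k = |U|\<close> and \<open>b = |N(U)|\<close>. If \<open>k + b > 39 + 2 (d - 1)\<close> then \<open>b > 2 (d - 1)\<close> at once. Otherwise
  sparsity of \<open>U \<union> N(U)\<close> gives \<open>b \<ge> (d - 1) k - e(U)\<close>. For \<open>k \<ge> 4\<close> the estimate \<open>e(U) \<le> k\<close>
  suffices, as \<open>4 (d - 2) \<ge> 2 (d - 1)\<close>. For \<open>k = 2, 3\<close> one uses \<open>e(U) \<le> k (k - 1)/2\<close>, which is
  improved by one if \<open>U\<close> is not complete. A complete pair outside all triangles is left to
  \<open>triangle_free_edge_boundary\<close>.
\<close>
lemma small_set_expansion:
  assumes reg: "regular_graph G d" and d: "d \<ge> 3"
    and dens: "max_density G (39 + 2 * (real d - 1)) \<le> 1"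
    and U: "U \<subseteq> pverts G" "2 \<le> card U" "card U \<le> 39"
  shows "2 * d - 3 \<le> card (outer_boundary G U)"
    and "(\<And>T. T \<in> triangles G \<Longrightarrow> \<not> U \<subseteq> T) \<Longrightarrow> 2 * d - 2 \<le> card (outer_boundary G U)"
proof -
  note rg = regular_graphD[OF reg]
  have finU: "finite U" using U(1) rg(1) by (rule finite_subset)
  define k where "k = card U"
  define b where "b = card (outer_boundary G U)"
  define W where "W = U \<union> outer_boundary G U"
  have W: "W \<subseteq> pverts G" "W \<noteq> {}"
    using U rg(6) by (auto simp: W_def outer_boundary_def)
  have cW: "card W = k + b"
    unfolding W_def k_def b_def using finU rg(5) by (intro card_Un_disjoint) (auto simp: outer_boundary_def)
  have key: "2 * d - 2 \<le> b \<or> (d - 1) * k \<le> b + card (edges_within G U)"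
  proof (cases "real (card W) \<le> 39 + 2 * (real d - 1)")
    case True
    have "card (edges_within G W) \<le> card W"
      by (rule card_edges_within_le_card[OF rg(1) dens W True])
    then have "d * k \<le> k + b + card (edges_within G U)"
      using degree_sum_le_edges[OF reg U(1)] cW by (simp add: W_def k_def)
    then have "d * k - k \<le> b + card (edges_within G U)" by linarith
    then show ?thesis by (simp add: diff_mult_distrib)
  next
    case False
    then have "real (39 + 2 * d) < real (card W + 2)" by simp
    then have "39 + 2 * d < card W + 2" unfolding of_nat_less_iff .
    then have "2 * d - 2 \<le> b" using cW U(3) unfolding k_def by linarith
    then show ?thesis ..
  qed
  have sparse: "card (edges_within G U) \<le> k"
    unfolding k_def by (rule card_edges_within_le_card[OF rg(1) dens U(1)]) (use U d in auto)
  obtain m where m: "d = m + 3" using d by (metis add.commute le_Suc_ex)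
  have big: "2 * d - 2 \<le> b" if "k \<ge> 4"
    using key
  proof
    assume "(d - 1) * k \<le> b + card (edges_within G U)"
    then have "(d - 1) * k \<le> b + k" using sparse by linarith
    then have "(m + 1) * k \<le> b" by (simp add: m add_mult_distrib)
    moreover have "(m + 1) * 4 \<le> (m + 1) * k" using that by (intro mult_le_mono2)
    ultimately show ?thesis by (simp add: m)
  qed
  have k23: "k = 2 \<or> k = 3" if "\<not> k \<ge> 4" using that U(2) by (auto simp: k_def)
  have choose: "2 choose 2 = (1::nat)" "3 choose 2 = (3::nat)" by (simp_all add: numeral_eq_Suc)
  have cases: "2 * d - 2 \<le> b \<or> k = 2 \<and> 2 * d - 2 \<le> b + card (edges_within G U) \<or>
      k = 3 \<and> 3 * d - 3 \<le> b + card (edges_within G U)"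
  proof (cases "k \<ge> 4")
    case False
    from k23[OF this] key show ?thesis by (elim disjE) (simp_all add: m)
  qed (use big in simp)
  show "2 * d - 3 \<le> card (outer_boundary G U)"
    using cases card_edges_within_le_choose(1)[OF reg finU] d
    unfolding k_def[symmetric] b_def[symmetric] by (elim disjE conjE) (simp_all add: choose)
  assume no: "\<And>T. T \<in> triangles G \<Longrightarrow> \<not> U \<subseteq> T"
  show "2 * d - 2 \<le> card (outer_boundary G U)"
  proof (cases "\<exists>u\<in>U. \<exists>v\<in>U. u \<noteq> v \<and> (u, v) \<notin> parcs G")
    case True
    then have "card (edges_within G U) < k choose 2"
      using card_edges_within_le_choose(2)[OF reg finU] unfolding k_def by blast
    then show ?thesis
      using cases d unfolding b_def[symmetric] by (elim disjE conjE) (simp_all add: choose)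
  next
    case complete: False
    show ?thesis
    proof (cases "k \<ge> 4")
      case True
      then show ?thesis using big by (simp add: b_def)
    next
      case False
      have "k \<noteq> 3"
      proof
        assume "k = 3"
        then have "U \<in> triangles G" using U(1) complete by (auto simp: triangles_def k_def)
        then show False using no by blast
      qed
      then have "card U = 2" using k23[OF False] by (simp add: k_def)
      then obtain u v where uv: "U = {u, v}" "u \<noteq> v" by (auto simp: card_2_iff)
      then have "(u, v) \<in> parcs G" using complete by auto
      from triangle_free_edge_boundary[OF reg this] no show ?thesis by (simp add: uv(1))
    qed
  qed
qed


section \<open>Connected sets and components\<close>

text \<open>
  Vertex sets that induce a connected subgraph, built by adding one adjacent vertex at a time;
  this form is the one from which a covering walk can be read off.
\<close>
inductive connected_set :: "'a pair_pre_digraph \<Rightarrow> 'a set \<Rightarrow> bool" for G where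
  single: "v \<in> pverts G \<Longrightarrow> connected_set G {v}"
| grow: "connected_set G U \<Longrightarrow> u \<in> U \<Longrightarrow> w \<in> neighbours G u \<Longrightarrow> w \<notin> U \<Longrightarrow> connected_set G (insert w U)"

definition walks :: "'a pair_pre_digraph \<Rightarrow> nat \<Rightarrow> 'a list set" where
  "walks G m = {xs. length xs = Suc m \<and> set xs \<subseteq> pverts G \<and> successively (\<lambda>u v. (u, v) \<in> parcs G) xs}"

lemma finite_walks: "finite (pverts G) \<Longrightarrow> finite (walks G m)"
  by (rule finite_subset[OF _ finite_lists_length_eq[of "pverts G" "Suc m"]]) (auto simp: walks_def)

lemma card_walks_le:
  assumes reg: "regular_graph G d"
  shows "card (walks G m) \<le> card (pverts G) * d ^ m"
proof (induction m)
  case 0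
  have "walks G 0 \<subseteq> (\<lambda>v. [v]) ` pverts G"
    by (auto simp: walks_def length_Suc_conv)
  then have "card (walks G 0) \<le> card (pverts G)"
    using regular_graphD(1)[OF reg] by (meson card_image_le card_mono finite_imageI order_trans)
  then show ?case by simp
next
  case (Suc m)
  note rg = regular_graphD[OF reg]
  have "walks G (Suc m) \<subseteq> (\<Union>xs\<in>walks G m. (\<lambda>x. x # xs) ` neighbours G (hd xs))"
  proof
    fix ys assume ys: "ys \<in> walks G (Suc m)"
    then obtain x y xs where yxs: "ys = x # y # xs" by (auto simp: walks_def length_Suc_conv)
    then have "y # xs \<in> walks G m" "x \<in> neighbours G (hd (y # xs))"
      using ys rg(3) by (auto simp: walks_def neighbours_def)
    then show "ys \<in> (\<Union>xs\<in>walks G m. (\<lambda>x. x # xs) ` neighbours G (hd xs))"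
      unfolding yxs by blast
  qed
  then have "card (walks G (Suc m)) \<le> card (\<Union>xs\<in>walks G m. (\<lambda>x. x # xs) ` neighbours G (hd xs))"
    by (rule card_mono[rotated]) (use finite_walks[OF rg(1)] rg(5) in auto)
  also have "\<dots> \<le> (\<Sum>xs\<in>walks G m. card ((\<lambda>x. x # xs) ` neighbours G (hd xs)))"
    by (rule card_UN_le[OF finite_walks[OF rg(1)]])
  also have "\<dots> \<le> (\<Sum>xs\<in>walks G m. d)"
  proof (rule sum_mono)
    fix xs assume "xs \<in> walks G m"
    then have "hd xs \<in> pverts G" by (cases xs) (auto simp: walks_def)
    then show "card ((\<lambda>x. x # xs) ` neighbours G (hd xs)) \<le> d"
      using card_image_le[OF rg(5)] rg(4) by metis
  qed
  also have "\<dots> \<le> card (pverts G) * d ^ m * d" using Suc by simp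
  finally show ?case by (simp add: mult_ac)
qed

text \<open>
  A walk through a connected set is extended to a new vertex \<open>w\<close> adjacent to \<open>u\<close> by a detour
  \<open>u, w, u\<close>, at the cost of two steps. This is the traversal of a spanning tree.
\<close>
lemma connected_set_walk:
  assumes reg: "regular_graph G d" and "connected_set G U"
  shows "U \<subseteq> pverts G \<and> finite U \<and> (\<exists>xs \<in> walks G (2 * (card U - 1)). set xs = U)"
  using assms(2)
proof induction
  case (single v)
  then have "[v] \<in> walks G (2 * (card {v} - 1))" by (simp add: walks_def)
  then show ?case using single by (intro conjI bexI[of _ "[v]"]) auto
next
  case (grow U u w)
  note rg = regular_graphD[OF reg]
  from grow obtain xs where xs: "xs \<in> walks G (2 * (card U - 1))" "set xs = U" by blast
  have uw: "(u, w) \<in> parcs G" "(w, u) \<in> parcs G" "w \<in> pverts G"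
    using grow rg(3) by (auto simp: neighbours_def)
  from grow(2) xs(2) obtain ys zs where yz: "xs = ys @ u # zs" by (metis split_list)
  have "card U > 0" using grow by (auto simp: card_gt_0_iff)
  then have "length (ys @ u # w # u # zs) = Suc (2 * (card (insert w U) - 1))"
    using xs(1) grow by (simp add: walks_def yz)
  then have "ys @ u # w # u # zs \<in> walks G (2 * (card (insert w U) - 1))"
    using xs(1) uw by (auto simp: walks_def yz successively_append_iff)
  moreover have "set (ys @ u # w # u # zs) = insert w U" using xs(2) yz by auto
  ultimately show ?case using grow uw by blast
qed

lemma card_connected_sets_le:
  assumes reg: "regular_graph G d"
  shows "card {U. connected_set G U \<and> card U = k} \<le> card (pverts G) * d ^ (2 * (k - 1))"
proof -
  have "{U. connected_set G U \<and> card U = k} \<subseteq> set ` walks G (2 * (k - 1))"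
    using connected_set_walk[OF reg] by fast
  then have "card {U. connected_set G U \<and> card U = k} \<le> card (walks G (2 * (k - 1)))"
    using finite_walks[OF regular_graphD(1)[OF reg]]
    by (meson card_image_le card_mono finite_imageI order_trans)
  then show ?thesis using card_walks_le[OF reg] order_trans by blast
qed

lemma arcs_ends_induce: "arcs_ends (with_proj G \<restriction> W) = {(u, v) \<in> parcs G. u \<in> W \<and> v \<in> W}"
  by (auto simp: arcs_ends_conv image_iff)

text \<open>
  A component of an induced subgraph is closed under adjacency among the remaining vertices, so
  its boundary in the whole graph is deleted. A maximal connected set inside the component
  is closed under adjacency as well and hence is the whole component.
\<close>
lemma component_of_induced_subgraph:
  assumes reg: "regular_graph G d" and W: "W \<subseteq> pverts G"
    and C: "C \<in> pre_digraph.sccs_verts (with_proj G \<restriction> W)"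
  shows "C \<subseteq> W" "connected_set G C" "outer_boundary G C \<inter> W = {}"
proof -
  note rg = regular_graphD[OF reg]
  define H where "H = with_proj G \<restriction> W"
  interpret P: pair_graph G using reg by (simp add: regular_graph_def)
  interpret H: wf_digraph H unfolding H_def by (rule P.wellformed_induce_subgraph)
  have VH: "verts H = W" by (simp add: H_def)
  have adj: "(u, v) \<in> arcs_ends H \<longleftrightarrow> u \<in> W \<and> v \<in> W \<and> v \<in> neighbours G u" for u v
    unfolding H_def arcs_ends_induce by (auto simp: neighbours_def)
  have "symmetric H"
    unfolding symmetric_def sym_def by (simp add: adj) (use rg(3) in \<open>auto simp: neighbours_def\<close>)
  then have reach_sym: "u \<rightarrow>\<^sup>*\<^bsub>H\<^esub> v \<Longrightarrow> v \<rightarrow>\<^sup>*\<^bsub>H\<^esub> u" for u v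
    by (rule symmetric_reachable)
  have C': "C \<noteq> {}" "\<And>u v. u \<in> C \<Longrightarrow> v \<in> C \<Longrightarrow> u \<rightarrow>\<^sup>*\<^bsub>H\<^esub> v"
    "\<And>u v. u \<in> C \<Longrightarrow> v \<notin> C \<Longrightarrow> \<not> u \<rightarrow>\<^sup>*\<^bsub>H\<^esub> v \<or> \<not> v \<rightarrow>\<^sup>*\<^bsub>H\<^esub> u"
    using C unfolding H_def[symmetric] H.in_sccs_verts_conv_reachable by auto
  show CW: "C \<subseteq> W" using C'(2) H.reachable_in_verts VH by blast
  have closed: "w \<in> C" if "u \<in> C" "w \<in> neighbours G u" "w \<in> W" for u w
  proof -
    have "u \<rightarrow>\<^sup>*\<^bsub>H\<^esub> w" using that CW adj by (intro H.reachable_adjI) auto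
    then show ?thesis using C'(3)[OF that(1), of w] reach_sym by blast
  qed
  then show "outer_boundary G C \<inter> W = {}" by (auto simp: outer_boundary_def)
  have finC: "finite C" using CW W rg(1) by (meson finite_subset)
  obtain v where v: "v \<in> C" using C'(1) by blast
  define F where "F = {X. X \<subseteq> C \<and> connected_set G X}"
  have "{v} \<in> F" using v CW W by (auto simp: F_def intro: connected_set.single)
  moreover have "finite F" using finC by (simp add: F_def)
  ultimately obtain X where X: "X \<in> F" "\<And>Y. Y \<in> F \<Longrightarrow> X \<subseteq> Y \<Longrightarrow> X = Y"
    using finite_has_maximal[of F] by blast
  have Xc: "X \<subseteq> C" "connected_set G X" using X(1) by (auto simp: F_def)
  have step: "w \<in> X" if "u \<in> X" "(u, w) \<in> arcs_ends H" for u w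
  proof (rule ccontr)
    assume "w \<notin> X"
    then have "connected_set G (insert w X)" using that adj Xc by (auto intro: connected_set.grow)
    moreover have "insert w X \<subseteq> C" using closed[of u w] that adj Xc by auto
    ultimately have "insert w X \<in> F" by (simp add: F_def)
    from X(2)[OF this] \<open>w \<notin> X\<close> show False by auto
  qed
  obtain x where x: "x \<in> X" using Xc(2) by (cases rule: connected_set.cases) auto
  have "w \<in> X" if "w \<in> C" for w
  proof -
    have "x \<rightarrow>\<^sup>*\<^bsub>H\<^esub> w" using C'(2) x Xc(1) that by auto
    then show ?thesis by (induction rule: H.reachable_induct) (use x step in auto)
  qed
  then have "X = C" using Xc(1) by auto
  then show "connected_set G C" using Xc(2) by simp
qed

text \<open>
  A component that is not listed first is disjoint from the first one and no larger, so it has at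
  most half of the vertices.
\<close>
lemma non_isolated_small_component:
  assumes reg: "regular_graph G d" and W: "W \<subseteq> pverts G"
    and bad: "\<not> small_components_isolated (with_proj G \<restriction> W)"
  obtains C where "connected_set G C" "2 \<le> card C" "2 * card C \<le> card (pverts G)"
    "outer_boundary G C \<inter> W = {}"
proof -
  note rg = regular_graphD[OF reg]
  define H where "H = with_proj G \<restriction> W"
  from bad obtain Vs C where ord: "component_ordering H Vs" and C: "C \<in> set (tl Vs)"
    and non: "\<And>v. isolated_vertex H v \<Longrightarrow> C \<noteq> {v}"
    unfolding small_components_isolated_def H_def by blast
  obtain B Bs where Vs: "Vs = B # Bs" "C \<in> set Bs" using C by (cases Vs) auto
  have sets: "B \<in> pre_digraph.sccs_verts H" "C \<in> pre_digraph.sccs_verts H" "B \<noteq> C" "card C \<le> card B"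
    using ord Vs unfolding component_ordering_def by auto
  interpret P: pair_graph G using reg by (simp add: regular_graph_def)
  interpret H: wf_digraph H unfolding H_def by (rule P.wellformed_induce_subgraph)
  note cC = component_of_induced_subgraph[OF reg W sets(2)[unfolded H_def]]
  note cB = component_of_induced_subgraph[OF reg W sets(1)[unfolded H_def]]
  have fin: "finite B" "finite C" using cC(1) cB(1) W rg(1) by (meson finite_subset)+
  have "card C + card B = card (C \<union> B)"
    using fin H.sccs_verts_disjoint[OF sets(2,1)] sets(3) by (simp add: card_Un_disjoint)
  also have "\<dots> \<le> card (pverts G)" using cC(1) cB(1) W rg(1) by (intro card_mono) auto
  finally have half: "2 * card C \<le> card (pverts G)" using sets(4) by simp
  have "card C \<noteq> 0" using cC(2) fin(2) by (cases rule: connected_set.cases) auto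
  moreover have "card C \<noteq> 1"
  proof
    assume "card C = 1"
    then obtain v where v: "C = {v}" by (auto simp: card_1_singleton_iff)
    have "isolated_vertex H v"
      using v cC(1,3) rg(3)
      by (auto simp: isolated_vertex_def H_def arcs_ends_induce outer_boundary_def neighbours_def)
    then show False using non v by blast
  qed
  ultimately have "2 \<le> card C" by linarith
  then show thesis using that cC half by blast
qed


section \<open>The union bound\<close>

lemma prob_all_deleted:
  assumes V: "finite V" "B \<subseteq> V" and p: "0 \<le> p" "p \<le> 1"
  shows "measure_pmf.prob (Pi_pmf V False (\<lambda>_. bernoulli_pmf p)) {f. \<forall>v\<in>B. f v} = p ^ card B"
proof -
  let ?X = "\<lambda>v. if v \<in> B then {True} else UNIV"
  have "{f. \<forall>v\<in>B. f v} = Pi V ?X" using V(2) by (auto simp: Pi_iff split: if_splits)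
  then have "measure_pmf.prob (Pi_pmf V False (\<lambda>_. bernoulli_pmf p)) {f. \<forall>v\<in>B. f v} =
      (\<Prod>v\<in>V. measure_pmf.prob (bernoulli_pmf p) (?X v))"
    using measure_Pi_pmf_Pi[OF V(1)] by simp
  also have "\<dots> = (\<Prod>v\<in>V. if v \<in> B then p else 1)"
    using p by (intro prod.cong) (auto simp: measure_pmf_single)
  also have "\<dots> = p ^ card B"
    using V by (simp add: prod.If_cases Int_absorb1)
  finally show ?thesis .
qed

lemma prob_not_isolated_le_sum:
  assumes reg: "regular_graph G d" and p: "0 \<le> p" "p \<le> 1"
  shows "measure_pmf.prob (deletion_pmf G p) {H. \<not> small_components_isolated H} \<le>
    (\<Sum>U | connected_set G U \<and> 2 \<le> card U \<and> 2 * card U \<le> card (pverts G). p ^ card (outer_boundary G U))"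
proof -
  note rg = regular_graphD[OF reg]
  let ?I = "{U. connected_set G U \<and> 2 \<le> card U \<and> 2 * card U \<le> card (pverts G)}"
  let ?P = "Pi_pmf (pverts G) False (\<lambda>_. bernoulli_pmf p)"
  have bd: "outer_boundary G U \<subseteq> pverts G" for U using rg(6) by (auto simp: outer_boundary_def)
  have "?I \<subseteq> Pow (pverts G)" using connected_set_walk[OF reg] by auto
  then have fin: "finite ?I" by (rule finite_subset) (use rg(1) in auto)
  have "measure_pmf.prob (deletion_pmf G p) {H. \<not> small_components_isolated H} =
     measure_pmf.prob ?P {del. \<not> small_components_isolated (with_proj G \<restriction> {v \<in> pverts G. \<not> del v})}"
    by (simp add: deletion_pmf_def vimage_def)
  also have "\<dots> \<le> measure_pmf.prob ?P (\<Union>U\<in>?I. {del. \<forall>v\<in>outer_boundary G U. del v})"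
  proof (rule measure_pmf.finite_measure_mono)
    show "{del. \<not> small_components_isolated (with_proj G \<restriction> {v \<in> pverts G. \<not> del v})} \<subseteq>
        (\<Union>U\<in>?I. {del. \<forall>v\<in>outer_boundary G U. del v})"
    proof
      fix del assume "del \<in> {del. \<not> small_components_isolated (with_proj G \<restriction> {v \<in> pverts G. \<not> del v})}"
      then obtain C where C: "connected_set G C" "2 \<le> card C" "2 * card C \<le> card (pverts G)"
          "outer_boundary G C \<inter> {v \<in> pverts G. \<not> del v} = {}"
        using non_isolated_small_component[OF reg, of "{v \<in> pverts G. \<not> del v}"] by auto
      then show "del \<in> (\<Union>U\<in>?I. {del. \<forall>v\<in>outer_boundary G U. del v})"
        using bd[of C] by blast
    qed
  qed simp
  also have "\<dots> \<le> (\<Sum>U\<in>?I. measure_pmf.prob ?P {del. \<forall>v\<in>outer_boundary G U. del v})"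
    by (rule measure_pmf.finite_measure_subadditive_finite[OF fin]) simp
  also have "\<dots> = (\<Sum>U\<in>?I. p ^ card (outer_boundary G U))"
    by (simp add: prob_all_deleted[OF rg(1) bd p])
  finally show ?thesis .
qed

lemma card_subsets_of_triangles_le:
  assumes "finite (pverts G)"
  shows "card {U. \<exists>T\<in>triangles G. U \<subseteq> T} \<le> 8 * num_triangles G"
    and "finite {U. \<exists>T\<in>triangles G. U \<subseteq> T}"
proof -
  have fT: "finite (triangles G)"
    by (rule finite_subset[of _ "Pow (pverts G)"]) (use assms in \<open>auto simp: triangles_def\<close>)
  have T: "finite T \<and> card T = 3" if "T \<in> triangles G" for T
    using that by (auto simp: triangles_def intro: card_ge_0_finite)
  have eq: "{U. \<exists>T\<in>triangles G. U \<subseteq> T} = (\<Union>T\<in>triangles G. Pow T)" by auto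
  have "card (\<Union>T\<in>triangles G. Pow T) \<le> (\<Sum>T\<in>triangles G. card (Pow T))" by (rule card_UN_le[OF fT])
  also have "\<dots> = (\<Sum>T\<in>triangles G. 8)" using T by (intro sum.cong) (auto simp: card_Pow)
  also have "\<dots> = 8 * num_triangles G" by (simp add: num_triangles_def triangles_def)
  finally show "card {U. \<exists>T\<in>triangles G. U \<subseteq> T} \<le> 8 * num_triangles G" unfolding eq .
  show "finite {U. \<exists>T\<in>triangles G. U \<subseteq> T}" unfolding eq using fT T by auto
qed

text \<open>
  The geometric series over all sizes. The truncated subtraction makes the weight 1 for the sets of
  size at most 40, whose number is at most a constant times \<open>n\<close>.
\<close>
lemma sum_connected_sets_le:
  fixes q :: real
  assumes reg: "regular_graph G d" and d: "d \<ge> 1" and q: "0 \<le> q" "real d ^ 2 * q \<le> 1 / 2"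
  shows "(\<Sum>U | connected_set G U \<and> card U \<le> N. q ^ (card U - 40)) \<le>
     2 ^ 41 * real d ^ 80 * card (pverts G)"
proof -
  note rg = regular_graphD[OF reg]
  define F where "F = {U. connected_set G U \<and> card U \<le> N}"
  have "F \<subseteq> Pow (pverts G)" using connected_set_walk[OF reg] by (auto simp: F_def)
  then have fin: "finite F" by (rule finite_subset) (use rg(1) in auto)
  have "(\<Sum>U\<in>F. q ^ (card U - 40)) = (\<Sum>k\<le>N. \<Sum>U | U \<in> F \<and> card U = k. q ^ (card U - 40))"
    by (rule sum.group[symmetric]) (use fin in \<open>auto simp: F_def\<close>)
  also have "\<dots> = (\<Sum>k\<le>N. real (card {U. connected_set G U \<and> card U = k}) * q ^ (k - 40))"
  proof (rule sum.cong[OF refl])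
    fix k assume "k \<in> {..N}"
    then have "{U \<in> F. card U = k} = {U. connected_set G U \<and> card U = k}" by (auto simp: F_def)
    then show "(\<Sum>U | U \<in> F \<and> card U = k. q ^ (card U - 40)) =
        real (card {U. connected_set G U \<and> card U = k}) * q ^ (k - 40)"
      by simp
  qed
  also have "\<dots> \<le> (\<Sum>k\<le>N. card (pverts G) * (2 ^ 40 * real d ^ 80 * (1 / 2) ^ k))"
  proof (rule sum_mono)
    fix k
    have "real d ^ (2 * (k - 1)) \<le> real d ^ (80 + 2 * (k - 40))"
      using d by (intro power_increasing) auto
    also have "\<dots> = real d ^ 80 * (real d ^ 2) ^ (k - 40)" by (simp only: power_add power_mult)
    finally have "real d ^ (2 * (k - 1)) * q ^ (k - 40) \<le>
        real d ^ 80 * (real d ^ 2) ^ (k - 40) * q ^ (k - 40)"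
      using q by (intro mult_right_mono) auto
    also have "\<dots> = real d ^ 80 * (real d ^ 2 * q) ^ (k - 40)"
      by (simp only: power_mult_distrib mult_ac)
    also have "\<dots> \<le> real d ^ 80 * (1 / 2) ^ (k - 40)"
      using q by (intro mult_left_mono power_mono) auto
    finally have b1: "real d ^ (2 * (k - 1)) * q ^ (k - 40) \<le> real d ^ 80 * (1 / 2) ^ (k - 40)" .
    have "(1 / 2 :: real) ^ (k - 40) \<le> 2 ^ 40 * (1 / 2) ^ k"
    proof (cases "k \<ge> 40")
      case True
      then have "(1 / 2 :: real) ^ k = (1 / 2) ^ (k - 40) * (1 / 2) ^ 40" by (simp flip: power_add)
      then show ?thesis by (simp add: power_divide)
    next
      case False
      then have "(2::real) ^ k \<le> 2 ^ 40" by (intro power_increasing) auto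
      then show ?thesis using False by (simp add: power_divide)
    qed
    then have b2: "real d ^ 80 * (1 / 2) ^ (k - 40) \<le> real d ^ 80 * (2 ^ 40 * (1 / 2) ^ k)"
      by (rule mult_left_mono) simp
    have "real (card {U. connected_set G U \<and> card U = k}) \<le> real (card (pverts G) * d ^ (2 * (k - 1)))"
      using card_connected_sets_le[OF reg, of k] of_nat_le_iff by blast
    then have "real (card {U. connected_set G U \<and> card U = k}) * q ^ (k - 40) \<le>
        real (card (pverts G) * d ^ (2 * (k - 1))) * q ^ (k - 40)"
      using q by (intro mult_right_mono) auto
    also have "\<dots> = card (pverts G) * (real d ^ (2 * (k - 1)) * q ^ (k - 40))" by simp
    also have "\<dots> \<le> card (pverts G) * (real d ^ 80 * (2 ^ 40 * (1 / 2) ^ k))"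
      by (rule mult_left_mono[OF order_trans[OF b1 b2]]) simp
    finally show "real (card {U. connected_set G U \<and> card U = k}) * q ^ (k - 40) \<le>
        card (pverts G) * (2 ^ 40 * real d ^ 80 * (1 / 2) ^ k)" by (simp only: mult_ac)
  qed
  also have "\<dots> = card (pverts G) * (2 ^ 40 * real d ^ 80) * (\<Sum>k\<le>N. (1 / 2) ^ k)"
    unfolding sum_distrib_left by (simp only: mult_ac)
  also have "\<dots> \<le> card (pverts G) * (2 ^ 40 * real d ^ 80) * 2"
  proof (rule mult_left_mono)
    have "(\<Sum>k\<le>N. (1 / 2 :: real) ^ k) \<le> (\<Sum>k. (1 / 2) ^ k)"
      by (rule sum_le_suminf) (auto intro!: summable_geometric)
    then show "(\<Sum>k\<le>N. (1 / 2 :: real) ^ k) \<le> 2" by (simp add: suminf_geometric)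
  qed simp
  finally show ?thesis by (simp add: F_def mult_ac)
qed

text \<open>
  The union bound, split into the sets contained in a triangle, which are few but may have only
  \<open>2d - 3\<close> boundary vertices, and all others, for which \<open>p powr c\<close> is the weight of each vertex
  beyond the fortieth.
\<close>
lemma prob_not_isolated_le:
  assumes reg: "regular_graph G d" and d: "d \<ge> 3"
    and dens: "max_density G (39 + 2 * (real d - 1)) \<le> 1"
    and p: "0 < p" "p \<le> 1" and c: "real d ^ 2 * p powr c \<le> 1 / 2"
    and large: "\<And>U. U \<subseteq> pverts G \<Longrightarrow> 40 \<le> card U \<Longrightarrow> 2 * card U \<le> card (pverts G) \<Longrightarrow>
       2 * (real d - 1) + c * (real (card U) - 40) \<le> card (outer_boundary G U)"
  shows "measure_pmf.prob (deletion_pmf G p) {H. \<not> small_components_isolated H} \<le>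
     8 * real (num_triangles G) * p ^ (2 * d - 3) + 2 ^ 41 * real d ^ 80 * card (pverts G) * p ^ (2 * d - 2)"
proof -
  note rg = regular_graphD[OF reg]
  define I where "I = {U. connected_set G U \<and> 2 \<le> card U \<and> 2 * card U \<le> card (pverts G)}"
  define I1 where "I1 = {U \<in> I. \<exists>T\<in>triangles G. U \<subseteq> T}"
  define I2 where "I2 = I - I1"
  have IV: "U \<subseteq> pverts G" "2 \<le> card U" "2 * card U \<le> card (pverts G)" if "U \<in> I" for U
    using that connected_set_walk[OF reg] by (auto simp: I_def)
  have fin: "finite I" by (rule finite_subset[of _ "Pow (pverts G)"]) (use IV rg(1) in auto)
  have "(\<Sum>U\<in>I1. p ^ card (outer_boundary G U)) \<le> (\<Sum>U\<in>I1. p ^ (2 * d - 3))"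
  proof (rule sum_mono)
    fix U assume U: "U \<in> I1"
    then obtain T where T: "U \<subseteq> T" "card T = 3" "U \<in> I" by (auto simp: I1_def triangles_def)
    then have "card U \<le> 3" using card_mono[of T U] card_ge_0_finite[of T] by simp
    then have "2 * d - 3 \<le> card (outer_boundary G U)"
      using small_set_expansion(1)[OF reg d dens] IV[OF T(3)] by simp
    then show "p ^ card (outer_boundary G U) \<le> p ^ (2 * d - 3)"
      using p by (intro power_decreasing) auto
  qed
  also have "\<dots> \<le> 8 * real (num_triangles G) * p ^ (2 * d - 3)"
  proof -
    have "card I1 \<le> card {U. \<exists>T\<in>triangles G. U \<subseteq> T}"
      using card_subsets_of_triangles_le(2)[OF rg(1)] by (intro card_mono) (auto simp: I1_def)
    then have "real (card I1) \<le> real (8 * num_triangles G)"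
      using card_subsets_of_triangles_le(1)[OF rg(1)] by (meson of_nat_le_iff order_trans)
    then show ?thesis using p by (simp add: mult_right_mono)
  qed
  finally have s1: "(\<Sum>U\<in>I1. p ^ card (outer_boundary G U)) \<le> 8 * real (num_triangles G) * p ^ (2 * d - 3)" .
  have "(\<Sum>U\<in>I2. p ^ card (outer_boundary G U)) \<le> (\<Sum>U\<in>I2. p ^ (2 * d - 2) * (p powr c) ^ (card U - 40))"
  proof (rule sum_mono)
    fix U assume "U \<in> I2"
    then have U: "U \<in> I" "\<And>T. T \<in> triangles G \<Longrightarrow> \<not> U \<subseteq> T" by (auto simp: I1_def I2_def)
    show "p ^ card (outer_boundary G U) \<le> p ^ (2 * d - 2) * (p powr c) ^ (card U - 40)"
    proof (cases "card U \<le> 39")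
      case True
      then have "2 * d - 2 \<le> card (outer_boundary G U)"
        using small_set_expansion(2)[OF reg d dens] IV[OF U(1)] U(2) by simp
      then show ?thesis using p True by (simp add: power_decreasing)
    next
      case False
      then have "2 * (real d - 1) + c * (real (card U) - 40) \<le> card (outer_boundary G U)"
        using large IV[OF U(1)] by simp
      then have "p powr card (outer_boundary G U) \<le> p powr (2 * (real d - 1) + c * (real (card U) - 40))"
        using p by (intro powr_mono') auto
      also have "\<dots> = p powr real (2 * d - 2) * (p powr c) powr real (card U - 40)"
        using d False by (simp add: powr_add powr_powr of_nat_diff)
      finally show ?thesis using p by (simp add: powr_realpow)
    qed
  qed
  also have "\<dots> = p ^ (2 * d - 2) * (\<Sum>U\<in>I2. (p powr c) ^ (card U - 40))"
    by (simp add: sum_distrib_left)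
  also have "\<dots> \<le> p ^ (2 * d - 2) * (2 ^ 41 * real d ^ 80 * card (pverts G))"
  proof (rule mult_left_mono)
    define F where "F = {U. connected_set G U \<and> card U \<le> card (pverts G)}"
    have "finite F"
      by (rule finite_subset[of _ "Pow (pverts G)"])
        (use connected_set_walk[OF reg] rg(1) in \<open>auto simp: F_def\<close>)
    moreover have "I2 \<subseteq> F" by (auto simp: I2_def I_def F_def)
    ultimately have "(\<Sum>U\<in>I2. (p powr c) ^ (card U - 40)) \<le> (\<Sum>U\<in>F. (p powr c) ^ (card U - 40))"
      by (intro sum_mono2) auto
    also have "\<dots> \<le> 2 ^ 41 * real d ^ 80 * card (pverts G)"
      unfolding F_def by (rule sum_connected_sets_le[OF reg]) (use d c in auto)
    finally show "(\<Sum>U\<in>I2. (p powr c) ^ (card U - 40)) \<le> 2 ^ 41 * real d ^ 80 * card (pverts G)" .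
  qed (use p in simp)
  finally have s2: "(\<Sum>U\<in>I2. p ^ card (outer_boundary G U)) \<le>
     2 ^ 41 * real d ^ 80 * card (pverts G) * p ^ (2 * d - 2)" by (simp only: mult_ac)
  have "(\<Sum>U\<in>I. p ^ card (outer_boundary G U)) =
      (\<Sum>U\<in>I2. p ^ card (outer_boundary G U)) + (\<Sum>U\<in>I1. p ^ card (outer_boundary G U))"
    unfolding I2_def by (rule sum.subset_diff) (use fin in \<open>auto simp: I1_def\<close>)
  then show ?thesis
    using prob_not_isolated_le_sum[OF reg, of p] p s1 s2 unfolding I_def by linarith
qed

theorem proposition3p6:
  fixes d :: nat and \<alpha> :: real
    and S :: "nat set"
    and G :: "nat \<Rightarrow> 'a::linorder pair_pre_digraph"
    and lam :: "nat \<Rightarrow> real"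
  assumes "d \<ge> 3"
    and "\<alpha> > 1 / (2 * (real d - 1))"
    and "\<And>n. n \<in> S \<Longrightarrow> ndlambda_graph (G n) n d (lam n)"
    and "\<And>n. n \<in> S \<Longrightarrow> lam n \<le> 2 * sqrt (real d - 1) + 1 / 40"
    and "\<And>n. n \<in> S \<Longrightarrow> max_density (G n) (39 + 2 * (real d - 1)) \<le> 1"
    and "(\<lambda>n. real (num_triangles (G n)))
           \<in> O[inf sequentially (principal S)](\<lambda>n. real n powr ((2 * real d - 3) / (2 * (real d - 1))))"
  shows "((\<lambda>n. measure_pmf.prob (deletion_pmf (G n) (real n powr - \<alpha>))
                 {H. small_components_isolated H})
           \<longlongrightarrow> 1) (inf sequentially (principal S))"
proof -
  define F where "F = inf sequentially (principal S)"
  define \<beta> where "\<beta> = 1 / (2 * (real d - 1))"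
  have d: "real d \<ge> 3" using assms(1) by simp
  have \<alpha>: "\<alpha> > \<beta>" "\<beta> > 0" using assms(2) d by (auto simp: \<beta>_def)
  obtain c :: real and n0 where c: "c > 0"
    "\<And>(H :: 'a pair_pre_digraph) n l U.
       n \<ge> n0 \<Longrightarrow> ndlambda_graph H n d l \<Longrightarrow> l \<le> 2 * sqrt (real d - 1) + 1 / 40 \<Longrightarrow> U \<subseteq> pverts H \<Longrightarrow>
       40 \<le> card U \<Longrightarrow> 2 * card U \<le> n \<Longrightarrow>
       2 * (real d - 1) + c * (real (card U) - 40) \<le> card (outer_boundary H U)"
  proof (rule large_set_expansion[OF _ spectral_threshold[OF assms(1)]])
    show "2 \<le> d" using assms(1) by simp
  qed (rule that)
  obtain C where C: "C > 0"
    and tri: "\<forall>\<^sub>F n in F. real (num_triangles (G n)) \<le> C * real n powr ((2 * real d - 3) / (2 * (real d - 1)))"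
    using landau_o.bigE[OF assms(6)] unfolding F_def[symmetric] by auto
  define K where "K = 2 ^ 41 * real d ^ 80"
  \<comment> \<open>sets inside a triangle, and all other sets\<close>
  define bound where "bound n = 8 * C * real n powr ((2 * real d - 3) * (\<beta> - \<alpha>)) +
     K * real n powr (1 - (2 * real d - 2) * \<alpha>)" for n :: nat
  have powr0: "((\<lambda>n. real n powr e) \<longlongrightarrow> 0) sequentially" if "e < 0" for e :: real
    using tendsto_neg_powr[OF that filterlim_real_sequentially] .
  have "bound \<longlonglongrightarrow> 8 * C * 0 + K * 0"
    unfolding bound_def
  proof (intro tendsto_intros powr0)
    show "(2 * real d - 3) * (\<beta> - \<alpha>) < 0" using \<alpha> d by (intro mult_pos_neg) auto
    have "(2 * real d - 2) * \<beta> = 1" using d by (simp add: \<beta>_def field_simps)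
    moreover have "(2 * real d - 2) * \<beta> < (2 * real d - 2) * \<alpha>"
      using \<alpha> d by (intro mult_strict_left_mono) auto
    ultimately show "1 - (2 * real d - 2) * \<alpha> < 0" by simp
  qed
  then have "(bound \<longlongrightarrow> 0) F"
    unfolding F_def by (intro tendsto_mono[OF inf_le1]) simp
  then have lower: "((\<lambda>n. 1 - bound n) \<longlongrightarrow> 1) F"
    using tendsto_diff[OF tendsto_const, of bound 0 F 1] by simp
  have inS: "\<forall>\<^sub>F n in F. n \<in> S" by (simp add: F_def eventually_inf_principal)
  have evF: "\<forall>\<^sub>F n in F. P n" if "\<forall>\<^sub>F n in sequentially. P n" for P
    using that unfolding F_def eventually_inf_principal by (rule eventually_mono) simp
  have "((\<lambda>n. real d ^ 2 * real n powr (- \<alpha> * c)) \<longlongrightarrow> real d ^ 2 * 0) sequentially"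
    using \<alpha> c(1) by (intro tendsto_intros powr0) (auto simp: mult_neg_pos)
  then have "\<forall>\<^sub>F n in sequentially. real d ^ 2 * real n powr (- \<alpha> * c) < 1 / 2"
    by (rule order_tendstoD) simp
  \<comment> \<open>a boundary that grows by \<open>c\<close> per vertex beats the number of connected sets\<close>
  then have q: "\<forall>\<^sub>F n in F. real d ^ 2 * real n powr (- \<alpha> * c) < 1 / 2" by (rule evF)
  have big: "\<forall>\<^sub>F n in F. n \<ge> max 1 n0" by (rule evF[OF eventually_ge_at_top])
  have "\<forall>\<^sub>F n in F. 1 - bound n \<le>
      measure_pmf.prob (deletion_pmf (G n) (real n powr - \<alpha>)) {H. small_components_isolated H}"
    using inS q big tri
  proof eventually_elim
    case (elim n)
    define p where "p = real n powr - \<alpha>"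
    have n: "n \<ge> 1" "n \<ge> n0" using elim by auto
    have p: "0 < p" "p \<le> 1"
      using n \<alpha> powr_mono[of "- \<alpha>" 0 "real n"] by (auto simp: p_def)
    have reg: "regular_graph (G n) d" and cardV: "card (pverts (G n)) = n"
      using assms(3)[OF elim(1)] by (auto simp: ndlambda_graph_def)
    have pow: "p ^ m = real n powr (- \<alpha> * m)" for m
      using p n by (simp add: powr_realpow[symmetric] p_def powr_powr)
    have "measure_pmf.prob (deletion_pmf (G n) p) {H. \<not> small_components_isolated H} \<le>
       8 * real (num_triangles (G n)) * p ^ (2 * d - 3) + 2 ^ 41 * real d ^ 80 * card (pverts (G n)) * p ^ (2 * d - 2)"
    proof (rule prob_not_isolated_le[OF reg assms(1) assms(5)[OF elim(1)] p])
      show "real d ^ 2 * p powr c \<le> 1 / 2" using elim(2) by (simp add: p_def powr_powr)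
      fix U assume "U \<subseteq> pverts (G n)" "40 \<le> card U" "2 * card U \<le> card (pverts (G n))"
      then show "2 * (real d - 1) + c * (real (card U) - 40) \<le> card (outer_boundary (G n) U)"
        using c(2)[OF n(2) assms(3)[OF elim(1)] assms(4)[OF elim(1)]] cardV by simp
    qed
    also have "8 * real (num_triangles (G n)) * p ^ (2 * d - 3) \<le>
       8 * (C * real n powr ((2 * real d - 3) / (2 * (real d - 1)))) * p ^ (2 * d - 3)"
      using elim(4) p by (intro mult_right_mono mult_left_mono) auto
    also have "\<dots> = 8 * C * real n powr ((2 * real d - 3) * (\<beta> - \<alpha>))"
    proof -
      have "(2 * real d - 3) / (2 * (real d - 1)) + - \<alpha> * real (2 * d - 3) = (2 * real d - 3) * (\<beta> - \<alpha>)"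
        using assms(1) by (simp add: \<beta>_def of_nat_diff algebra_simps)
      then show ?thesis unfolding pow by (simp add: powr_add[symmetric] mult.assoc)
    qed
    also have "2 ^ 41 * real d ^ 80 * card (pverts (G n)) * p ^ (2 * d - 2) =
        K * real n powr (1 - (2 * real d - 2) * \<alpha>)"
    proof -
      have "real n powr (1 - (2 * real d - 2) * \<alpha>) = real n powr 1 * real n powr (- \<alpha> * real (2 * d - 2))"
      proof -
        have "1 - (2 * real d - 2) * \<alpha> = 1 + - \<alpha> * real (2 * d - 2)"
          using assms(1) by (simp add: of_nat_diff algebra_simps)
        then show ?thesis by (simp only: powr_add)
      qed
      then show ?thesis unfolding pow cardV K_def using n by simp
    qed
    finally have "measure_pmf.prob (deletion_pmf (G n) p) {H. \<not> small_components_isolated H} \<le> bound n"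
      by (simp add: bound_def)
    moreover have "measure_pmf.prob (deletion_pmf (G n) p) {H. \<not> small_components_isolated H} =
        1 - measure_pmf.prob (deletion_pmf (G n) p) {H. small_components_isolated H}"
      using measure_pmf.prob_compl[of "{H. small_components_isolated H}" "deletion_pmf (G n) p"]
      by (simp add: Compl_eq_Diff_UNIV[symmetric] Collect_neg_eq)
    ultimately show ?case by (simp add: p_def)
  qed
  then show ?thesis
    unfolding F_def[symmetric]
    by (rule tendsto_sandwich[OF _ _ lower tendsto_const]) (simp add: measure_pmf.prob_le_1)
qed

end
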